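(* Consider a two-dimensional steady continuous stratified periodic water wave with known analytic streamline density function $\rho(-\psi)$ and known analytic Bernoulli function $\beta(\psi)$. Assume moreover that the horizontal velocity on the axis of symmetry, i.e. $u(0,y)$, and the wave height $\eta(0)$ are given. Then we can recover the wave profile, the velocity field and the pressure within the fluid.
   Context: Let $g>0$ be the gravitational acceleration, $y=-d$ (with $d>0$) the flat bed, $c$ the wave speed and $P_{atm}$ the constant atmospheric pressure. In the moving frame ($x=X-ct$, $y=Y$), a steady continuous stratified periodic water wave consists of a free surface profile $y=\eta(x)$ with $\int_{-\pi}^{\pi}\eta(x)\,dx=0$, a velocity field $(u,v)$, a pressure $P$ and a density $\rho>0$, all $2\pi$-periodic in $x$, with $u<c$ throughout the fluid (no stagnation points), satisfying $$ \begin{cases} u_x+v_y=0,\quad (u-c)\rho_x+v\rho_y=0 & \text{for } -d\le y\le\eta(x),\\ \rho(u-c)u_x+\rho v u_y=-P_x & \text{for } -d\le y\le\eta(x),\\ \rho(u-c)v_x+\rho v v_y=-P_y-g\rho & \text{for } -d\le y\le\eta(x),\\ v=0 & \text{on } y=-d,\\ v=(u-c)\eta_x,\quad P=P_{atm} & \text{on } y=\eta(x). \end{cases} $$ The pseudo-stream function $\psi$ is defined by $\psi_x=-\sqrt{\rho}\,v$, $\psi_y=\sqrt{\rho}\,(u-c)<0$, with $\psi=0$ on $y=\eta(x)$; then $\psi=-p_0>0$ on $y=-d$, where $p_0=\int_{-d}^{\eta(x)}\sqrt{\rho(x,y)}\,[u(x,y)-c]\,dy$ (the pseudo mass flux) does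 not depend on $x$. The streamlines are the level sets of $\psi$. The density is constant on streamlines, so there is a nonincreasing streamline density function, also denoted $\rho$, from $[p_0,0]$ to $\mathbb{R}^+$ with $\rho(x,y)=\rho(-\psi(x,y))$. The quantity $E=\frac{\rho}{2}\left((u-c)^2+v^2\right)+gy\rho+P$ is constant along each streamline, and the Bernoulli function $\beta$ on $[0,|p_0|]$ is defined by $\frac{dE}{d\psi}=-\beta(\psi)$; equivalently, $\Delta\psi-gy\rho'(-\psi)=-\beta(\psi)$ in the fluid. The solutions are classical: the height function $h(q,p)=y+d$, expressed in the variables $q=x$, $p=-\psi(x,y)$, belongs to $C^{2,\alpha}$ on $[-\pi,\pi]\times[p_0,0]$ for some $\alpha\in(0,1)$. The crest line is $x=0$, and every streamline (including the free surface) is symmetric about it; this line is the axis of symmetry. The wave height means $\eta(0)$, the value of the surface profile at the crest. To recover means to reconstruct from the given data. *)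

theory Defs
  imports "HOL-Analysis.Analysis"
begin

section \<open>Real analyticity and Hoelder regularity\<close>

text \<open>For a compact nondegenerate interval this is analyticity up to the end points
  (one-sided expansions there). Values of f outside S are irrelevant.\<close>

definition real_analytic_on :: "(real \<Rightarrow> real) \<Rightarrow> real set \<Rightarrow> bool" where
  "real_analytic_on f S \<longleftrightarrow>
     (\<forall>x\<in>S. \<exists>r>0. \<exists>a. \<forall>y\<in>S. \<bar>y - x\<bar> < r \<longrightarrow> (\<lambda>n. a n * (y - x) ^ n) sums f y)"

text \<open>Derivatives are taken within S, so that they make sense at boundary points, where
  slices of S parallel to the axes may degenerate (at the crest, for instance).\<close>

definition has_gradient_on ::
  "(real \<times> real \<Rightarrow> real) \<Rightarrow> (real \<times> real \<Rightarrow> real) \<Rightarrow> (real \<times> real \<Rightarrow> real) \<Rightarrow> (real \<times> real) set \<Rightarrow> bool"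
  where
  "has_gradient_on f fx fy S \<longleftrightarrow>
     (\<forall>z\<in>S. (f has_derivative (\<lambda>k. fx z * fst k + fy z * snd k)) (at z within S))"

definition holder_on :: "real \<Rightarrow> (real \<times> real) set \<Rightarrow> (real \<times> real \<Rightarrow> real) \<Rightarrow> bool" where
  "holder_on \<alpha> S f \<longleftrightarrow> (\<exists>K. \<forall>z\<in>S. \<forall>z'\<in>S. \<bar>f z - f z'\<bar> \<le> K * dist z z' powr \<alpha>)"

definition C2_holder_on :: "real \<Rightarrow> (real \<times> real) set \<Rightarrow> (real \<times> real \<Rightarrow> real) \<Rightarrow> bool" where
  "C2_holder_on \<alpha> S h \<longleftrightarrow>
     (\<exists>hq hp hqq hqp hpp.
        has_gradient_on h hq hp S \<and> has_gradient_on hq hqq hqp S \<and> has_gradient_on hp hqp hpp S \<and>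
        holder_on \<alpha> S hqq \<and> holder_on \<alpha> S hqp \<and> holder_on \<alpha> S hpp)"


section \<open>Steady stratified periodic waves\<close>

record wave =
  profile :: "real \<Rightarrow> real"
  hvel :: "real \<times> real \<Rightarrow> real"
  vvel :: "real \<times> real \<Rightarrow> real"
  pressure :: "real \<times> real \<Rightarrow> real"
  density :: "real \<times> real \<Rightarrow> real"

text \<open>The closed fluid domain; the fields of a wave are meaningful only there.\<close>

definition fluid :: "real \<Rightarrow> wave \<Rightarrow> (real \<times> real) set" where
  "fluid d W = {(x, y). - d \<le> y \<and> y \<le> profile W x}"

definition periodic_wave :: "real \<Rightarrow> wave \<Rightarrow> bool" where
  "periodic_wave d W \<longleftrightarrow>
     (\<forall>x. profile W (x + 2 * pi) = profile W x) \<and>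
     (\<forall>f\<in>{hvel W, vvel W, pressure W, density W}.
        \<forall>(x, y)\<in>fluid d W. f (x + 2 * pi, y) = f (x, y))"

definition euler_equations :: "real \<Rightarrow> real \<Rightarrow> real \<Rightarrow> wave \<Rightarrow> bool" where
  "euler_equations g d c W \<longleftrightarrow>
     (let D = fluid d W; u = hvel W; v = vvel W; P = pressure W; \<rho> = density W in
      \<exists>ux uy vx vy Px Py \<rho>x \<rho>y.
        has_gradient_on u ux uy D \<and> has_gradient_on v vx vy D \<and>
        has_gradient_on P Px Py D \<and> has_gradient_on \<rho> \<rho>x \<rho>y D \<and>
        (\<forall>z\<in>D.
           ux z + vy z = 0 \<and>
           (u z - c) * \<rho>x z + v z * \<rho>y z = 0 \<and>
           \<rho> z * (u z - c) * ux z + \<rho> z * v z * uy z = - Px z \<and>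
           \<rho> z * (u z - c) * vx z + \<rho> z * v z * vy z = - Py z - g * \<rho> z))"

definition boundary_conditions :: "real \<Rightarrow> real \<Rightarrow> real \<Rightarrow> wave \<Rightarrow> bool" where
  "boundary_conditions d c Patm W \<longleftrightarrow>
     (\<forall>x. vvel W (x, - d) = 0) \<and>
     (\<exists>\<eta>x. \<forall>x. (profile W has_real_derivative \<eta>x x) (at x) \<and>
        vvel W (x, profile W x) = (hvel W (x, profile W x) - c) * \<eta>x x) \<and>
     (\<forall>x. pressure W (x, profile W x) = Patm)"

definition steady_wave :: "real \<Rightarrow> real \<Rightarrow> real \<Rightarrow> real \<Rightarrow> wave \<Rightarrow> bool" where
  "steady_wave g d c Patm W \<longleftrightarrow>
     (\<forall>x. - d < profile W x) \<and>
     (profile W has_integral 0) {- pi..pi} \<and>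
     periodic_wave d W \<and>
     (\<forall>z\<in>fluid d W. 0 < density W z) \<and>
     (\<forall>z\<in>fluid d W. hvel W z < c) \<and>
     euler_equations g d c W \<and>
     boundary_conditions d c Patm W"

definition pseudo_stream_function ::
  "real \<Rightarrow> real \<Rightarrow> wave \<Rightarrow> (real \<times> real \<Rightarrow> real) \<Rightarrow> bool" where
  "pseudo_stream_function d c W \<psi> \<longleftrightarrow>
     has_gradient_on \<psi> (\<lambda>z. - sqrt (density W z) * vvel W z)
       (\<lambda>z. sqrt (density W z) * (hvel W z - c)) (fluid d W) \<and>
     (\<forall>x. \<psi> (x, profile W x) = 0)"

definition pseudo_mass_flux :: "real \<Rightarrow> real \<Rightarrow> wave \<Rightarrow> real \<Rightarrow> bool" where
  "pseudo_mass_flux d c W p0 \<longleftrightarrow>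
     (\<forall>x. ((\<lambda>y. sqrt (density W (x, y)) * (hvel W (x, y) - c)) has_integral p0) {- d..profile W x})"

definition streamline :: "real \<Rightarrow> wave \<Rightarrow> (real \<times> real \<Rightarrow> real) \<Rightarrow> real \<Rightarrow> (real \<times> real) set" where
  "streamline d W \<psi> s = {z \<in> fluid d W. \<psi> z = s}"

text \<open>Since u < c, the function y \<mapsto> - psi (x, y) is a bijection of [-d, eta(x)] onto [p0, 0]
  for each x, so this determines h on all of \<real> \<times> [p0, 0].\<close>

definition height_function ::
  "real \<Rightarrow> wave \<Rightarrow> (real \<times> real \<Rightarrow> real) \<Rightarrow> (real \<times> real \<Rightarrow> real) \<Rightarrow> bool" where
  "height_function d W \<psi> h \<longleftrightarrow> (\<forall>(x, y)\<in>fluid d W. h (x, - \<psi> (x, y)) = y + d)"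

definition classical_wave :: "real \<Rightarrow> wave \<Rightarrow> (real \<times> real \<Rightarrow> real) \<Rightarrow> real \<Rightarrow> bool" where
  "classical_wave d W \<psi> p0 \<longleftrightarrow>
     (\<exists>h \<alpha>. 0 < \<alpha> \<and> \<alpha> < 1 \<and> height_function d W \<psi> h \<and>
        C2_holder_on \<alpha> ({- pi..pi} \<times> {p0..0}) h)"

definition symmetric_about_crest :: "real \<Rightarrow> wave \<Rightarrow> (real \<times> real \<Rightarrow> real) \<Rightarrow> bool" where
  "symmetric_about_crest d W \<psi> \<longleftrightarrow>
     (\<forall>x. profile W x \<le> profile W 0) \<and>
     (\<forall>s. (\<lambda>(x, y). (- x, y)) ` streamline d W \<psi> s = streamline d W \<psi> s)"

definition streamline_density ::
  "real \<Rightarrow> wave \<Rightarrow> (real \<times> real \<Rightarrow> real) \<Rightarrow> real \<Rightarrow> (real \<Rightarrow> real) \<Rightarrow> bool" where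
  "streamline_density d W \<psi> p0 r \<longleftrightarrow>
     antimono_on {p0..0} r \<and> (\<forall>p\<in>{p0..0}. 0 < r p) \<and>
     (\<forall>z\<in>fluid d W. density W z = r (- \<psi> z))"

definition energy :: "real \<Rightarrow> real \<Rightarrow> wave \<Rightarrow> real \<times> real \<Rightarrow> real" where
  "energy g c W z = density W z / 2 * ((hvel W z - c)\<^sup>2 + (vvel W z)\<^sup>2)
     + g * snd z * density W z + pressure W z"

text \<open>Here E expresses the energy as a function of the streamline.\<close>

definition bernoulli_function ::
  "real \<Rightarrow> real \<Rightarrow> real \<Rightarrow> wave \<Rightarrow> (real \<times> real \<Rightarrow> real) \<Rightarrow> real \<Rightarrow> (real \<Rightarrow> real) \<Rightarrow> bool" where
  "bernoulli_function g d c W \<psi> p0 \<beta> \<longleftrightarrow>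
     (\<exists>E. (\<forall>z\<in>fluid d W. energy g c W z = E (\<psi> z)) \<and>
        (\<forall>s\<in>{0..\<bar>p0\<bar>}. (E has_real_derivative - \<beta> s) (at s within {0..\<bar>p0\<bar>})))"

text \<open>A wave as above together with its pseudo-stream function, pseudo mass flux, streamline
  density function r and Bernoulli function.\<close>

definition symmetric_stratified_wave ::
  "real \<Rightarrow> real \<Rightarrow> real \<Rightarrow> real \<Rightarrow> wave \<Rightarrow> (real \<times> real \<Rightarrow> real) \<Rightarrow> real \<Rightarrow>
   (real \<Rightarrow> real) \<Rightarrow> (real \<Rightarrow> real) \<Rightarrow> bool" where
  "symmetric_stratified_wave g d c Patm W \<psi> p0 r \<beta> \<longleftrightarrow>
     steady_wave g d c Patm W \<and>
     pseudo_stream_function d c W \<psi> \<and>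
     pseudo_mass_flux d c W p0 \<and>
     classical_wave d W \<psi> p0 \<and>
     symmetric_about_crest d W \<psi> \<and>
     streamline_density d W \<psi> p0 r \<and>
     bernoulli_function g d c W \<psi> p0 \<beta>"

end

(*
Two waves W1, W2 with the same data have to coincide. Their pseudo-stream functions solve the
semilinear elliptic equation Laplacian psi = g y rho'(-psi) - beta(psi). On the axis of symmetry
psi is determined by u(0, y) through the ODE psi_y = sqrt(rho(-psi)) (u - c), and psi_x vanishes
by symmetry, so the difference w = psi1 - psi2 has zero Cauchy data on x = 0. With
f = w_x - i w_y and dbar = d/dx + i d/dy this reads

  dbar w = cnj f,   dbar f = Laplacian w,   |dbar f| <= C |w| locally,

since rho' and beta are locally Lipschitz. This is the only use of analyticity: instead of the
Cauchy-Kovalevskaya theorem the proof uses unique continuation, which needs no analyticity of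
the solution. The pair (f, w) extends by zero to x < 0 as a continuously differentiable pair with
the same bound, hence vanishes on the whole connected set below both surfaces, by Carleman's method
based on the inequality ||G|| <= 2 R ||dbar G|| for G supported in a square of side 2 R. Equality
of psi then forces equality of the profiles, the velocities and, by Bernoulli's law, the pressures.
*)

theory Submission
  imports Defs
begin

section \<open>Continuously differentiable functions in the plane\<close>

text \<open>The stream function is available only with C^2 regularity inside one period, so f and w
  are merely C^1 and nothing may be differentiated twice. This shapes the tools: the elliptic
  equation is kept as a first order system, the Jacobian identity behind the Poincare inequality is
  proved by translations, and C^1 cutoffs suffice. Even C^1 regularity of grad psi has to be
  extracted from the height function, because the Euler equations are stated with pointwise
  gradients that carry no continuity. The extension by zero across x = 0 works because f vanishes
  along the axis, which gives py f = 0, and dbar f vanishes there as well, which leaves px f = 0.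
  The two fluid domains may differ until the very end, so the comparison takes place on their common
  part over one period; symmetry, continuity and periodicity then reach the rest. Recovery itself is
  uniqueness: the operator picks some wave with the given data, and uniqueness makes its output
  independent of the choice.\<close>

definition px :: "(real \<times> real \<Rightarrow> 'a::real_normed_vector) \<Rightarrow> real \<times> real \<Rightarrow> 'a" where
  "px f z = frechet_derivative f (at z) (1, 0)"

definition py :: "(real \<times> real \<Rightarrow> 'a::real_normed_vector) \<Rightarrow> real \<times> real \<Rightarrow> 'a" where
  "py f z = frechet_derivative f (at z) (0, 1)"

text \<open>Meant for open \<open>S\<close>: derivatives are full ones \<open>at z\<close>, while
  \<open>px\<close> and \<open>py\<close> are total functions whose values carry information only at
  points of differentiability.\<close>

definition c1 :: "(real \<times> real) set \<Rightarrow> (real \<times> real \<Rightarrow> 'a::real_normed_vector) \<Rightarrow> bool" where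
  "c1 S f \<longleftrightarrow> (\<forall>z\<in>S. f differentiable (at z)) \<and> continuous_on S (px f) \<and> continuous_on S (py f)"

lemma has_derivative_px: "(f has_derivative f') (at z) \<Longrightarrow> px f z = f' (1, 0)"
  and has_derivative_py: "(f has_derivative f') (at z) \<Longrightarrow> py f z = f' (0, 1)"
  by (simp_all add: px_def py_def flip: frechet_derivative_at)

lemma differentiable_has_derivative:
  assumes "f differentiable (at z)"
  shows "(f has_derivative (\<lambda>k. fst k *\<^sub>R px f z + snd k *\<^sub>R py f z)) (at z)"
proof -
  have d: "(f has_derivative frechet_derivative f (at z)) (at z)"
    using assms by (simp add: frechet_derivative_works)
  then interpret linear "frechet_derivative f (at z)"
    by (rule has_derivative_linear)
  have "frechet_derivative f (at z) k = fst k *\<^sub>R px f z + snd k *\<^sub>R py f z" for k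
  proof -
    have "k = fst k *\<^sub>R (1, 0) + snd k *\<^sub>R (0, 1)" by (simp add: prod_eq_iff)
    then show ?thesis unfolding px_def py_def by (metis add scale)
  qed
  then show ?thesis using d by (simp add: has_derivative_eq_rhs fun_eq_iff)
qed

lemma c1_differentiable: "c1 S f \<Longrightarrow> z \<in> S \<Longrightarrow> f differentiable (at z)"
  by (simp add: c1_def)

lemma c1D:
  "c1 S f \<Longrightarrow> z \<in> S \<Longrightarrow> (f has_derivative (\<lambda>k. fst k *\<^sub>R px f z + snd k *\<^sub>R py f z)) (at z)"
  by (simp add: c1_def differentiable_has_derivative)

text \<open>Explicit coefficient functions with \<open>scaleR\<close> let one rule serve real and
  complex values, and it is their continuity, not that of \<open>px\<close> and \<open>py\<close>,
  that has to be checked.\<close>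

lemma c1I:
  assumes "\<And>z. z \<in> S \<Longrightarrow> (f has_derivative (\<lambda>k. fst k *\<^sub>R fx z + snd k *\<^sub>R fy z)) (at z)"
    and "continuous_on S fx" "continuous_on S fy"
  shows "c1 S f"
proof -
  have "px f z = fx z" "py f z = fy z" if "z \<in> S" for z
    using assms(1)[OF that] by (simp_all add: has_derivative_px has_derivative_py)
  moreover have "f differentiable (at z)" if "z \<in> S" for z
    using assms(1)[OF that] by (rule differentiableI)
  ultimately show ?thesis
    using assms(2,3) by (simp add: c1_def cong: continuous_on_cong)
qed

lemma c1_subset: "c1 S f \<Longrightarrow> T \<subseteq> S \<Longrightarrow> c1 T f"
  by (auto simp: c1_def intro: continuous_on_subset)

lemma c1_Un: "open S \<Longrightarrow> open T \<Longrightarrow> c1 S f \<Longrightarrow> c1 T f \<Longrightarrow> c1 (S \<union> T) f"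
  by (auto simp: c1_def intro: continuous_on_open_Un)

lemma c1_continuous_on: "c1 S f \<Longrightarrow> continuous_on S f"
  by (auto simp: c1_def intro!: continuous_at_imp_continuous_on differentiable_imp_continuous_within)

lemma px_cong:
  assumes "open S" "z \<in> S" "\<And>w. w \<in> S \<Longrightarrow> f w = g w"
  shows "px f z = px g z" "py f z = py g z" "f differentiable (at z) \<longleftrightarrow> g differentiable (at z)"
proof -
  have "(f has_derivative D) (at z) \<longleftrightarrow> (g has_derivative D) (at z)" for D
    using has_derivative_transform_within_open[OF _ assms(1,2), of f D UNIV g]
      has_derivative_transform_within_open[OF _ assms(1,2), of g D UNIV f] assms(3) by auto
  then show "px f z = px g z" "py f z = py g z" "f differentiable (at z) \<longleftrightarrow> g differentiable (at z)"
    unfolding px_def py_def frechet_derivative_def differentiable_def by simp_all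
qed

lemma c1_cong:
  assumes "open S" "\<And>w. w \<in> S \<Longrightarrow> f w = g w"
  shows "c1 S f \<longleftrightarrow> c1 S g"
proof -
  have *: "px f z = px g z" "py f z = py g z" "f differentiable (at z) \<longleftrightarrow> g differentiable (at z)" if "z \<in> S" for z
    using px_cong[OF assms(1) that assms(2)] by auto
  show ?thesis
    unfolding c1_def
    by (simp add: * continuous_on_cong[OF refl, of S "px f" "px g"]
        continuous_on_cong[OF refl, of S "py f" "py g"] cong: ball_cong)
qed

lemma c1_const: "c1 S (\<lambda>z. c)"
  by (rule c1I[where fx = "\<lambda>_. 0" and fy = "\<lambda>_. 0"]) (auto intro!: derivative_eq_intros)

lemma
  assumes "f differentiable (at z)" "g differentiable (at z)"
  shows px_diff: "px (\<lambda>w. f w - g w) z = px f z - px g z"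
    and py_diff: "py (\<lambda>w. f w - g w) z = py f z - py g z"
  using has_derivative_diff[OF assms[THEN differentiable_has_derivative]]
  by (simp_all add: has_derivative_px has_derivative_py)

lemma c1_diff: "c1 S f \<Longrightarrow> c1 S g \<Longrightarrow> c1 S (\<lambda>z. f z - g z)"
  by (rule c1I[where fx = "\<lambda>z. px f z - px g z" and fy = "\<lambda>z. py f z - py g z"])
    (auto intro!: derivative_eq_intros c1D continuous_intros simp: c1_def algebra_simps)

lemma px_bounded_linear:
  assumes "bounded_linear h" "f differentiable (at z)"
  shows "px (\<lambda>w. h (f w)) z = h (px f z)" "py (\<lambda>w. h (f w)) z = h (py f z)"
  using bounded_linear.has_derivative[OF assms(1) differentiable_has_derivative[OF assms(2)]]
  by (simp_all add: has_derivative_px has_derivative_py)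

lemma c1_bounded_linear:
  assumes "bounded_linear h" "c1 S f"
  shows "c1 S (\<lambda>z. h (f z))"
proof -
  interpret bounded_linear h by fact
  show ?thesis
  proof (rule c1I[where fx = "\<lambda>z. h (px f z)" and fy = "\<lambda>z. h (py f z)"])
    fix z assume "z \<in> S"
    from has_derivative[OF c1D[OF assms(2) this]]
    show "((\<lambda>z. h (f z)) has_derivative (\<lambda>k. fst k *\<^sub>R h (px f z) + snd k *\<^sub>R h (py f z))) (at z)"
      by (simp add: add scaleR)
  qed (use assms(2) in \<open>auto simp: c1_def intro: continuous_on\<close>)
qed

lemma
  fixes f g :: "real \<times> real \<Rightarrow> 'a::real_normed_algebra"
  assumes "f differentiable (at z)" "g differentiable (at z)"
  shows px_mult: "px (\<lambda>w. f w * g w) z = f z * px g z + px f z * g z"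
    and py_mult: "py (\<lambda>w. f w * g w) z = f z * py g z + py f z * g z"
  using has_derivative_mult[OF assms[THEN differentiable_has_derivative]]
  by (simp_all add: has_derivative_px has_derivative_py)

lemma c1_mult:
  fixes f g :: "real \<times> real \<Rightarrow> 'a::real_normed_algebra"
  assumes "c1 S f" "c1 S g"
  shows "c1 S (\<lambda>z. f z * g z)"
proof (rule c1I[where fx = "\<lambda>z. f z * px g z + px f z * g z" and fy = "\<lambda>z. f z * py g z + py f z * g z"])
  fix z assume "z \<in> S"
  from has_derivative_mult[OF c1D[OF assms(1) this] c1D[OF assms(2) this]]
  show "((\<lambda>z. f z * g z) has_derivative
    (\<lambda>k. fst k *\<^sub>R (f z * px g z + px f z * g z) + snd k *\<^sub>R (f z * py g z + py f z * g z))) (at z)"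
    by (simp add: algebra_simps)
qed (use assms c1_continuous_on[OF assms(1)] c1_continuous_on[OF assms(2)] in
    \<open>auto simp: c1_def intro!: continuous_intros\<close>)

section \<open>Slices, integration by parts and translations in the plane\<close>

lemma has_vector_derivative_px:
  assumes "f differentiable (at (x, y))"
  shows "((\<lambda>t. f (t, y)) has_vector_derivative px f (x, y)) (at x within T)"
proof -
  have "((\<lambda>t::real. (t, y)) has_derivative (\<lambda>t. (t, 0))) (at x within T)"
    by (auto intro!: derivative_eq_intros)
  from diff_chain_within[OF this has_derivative_at_withinI[OF differentiable_has_derivative[OF assms]]]
  show ?thesis by (simp add: has_vector_derivative_def o_def)
qed

lemma has_vector_derivative_py:
  assumes "f differentiable (at (x, y))"
  shows "((\<lambda>t. f (x, t)) has_vector_derivative py f (x, y)) (at y within T)"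
proof -
  have "((\<lambda>t::real. (x, t)) has_derivative (\<lambda>t. (0, t))) (at y within T)"
    by (auto intro!: derivative_eq_intros)
  from diff_chain_within[OF this has_derivative_at_withinI[OF differentiable_has_derivative[OF assms]]]
  show ?thesis by (simp add: has_vector_derivative_def o_def)
qed

text \<open>Fubini makes the x-integration the inner one, and the fundamental theorem on each
  horizontal line leaves only boundary values.\<close>

lemma integral_px_eq_0:
  fixes k :: "real \<times> real \<Rightarrow> real"
  assumes k: "c1 UNIV k" and z: "\<And>x y. x \<in> {a, b} \<Longrightarrow> k (x, y) = 0" and ab: "a \<le> b"
  shows "integral (cbox (a, c) (b, d)) (px k) = 0"
proof -
  have cont: "continuous_on S (\<lambda>(x, y). px k (x, y))" "continuous_on S (px k)" for S
    using k by (auto simp: c1_def intro: continuous_on_subset)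
  have "integral (cbox (a, c) (b, d)) (px k) = integral (cbox a b) (\<lambda>x. integral (cbox c d) (\<lambda>y. px k (x, y)))"
    by (rule integral_prod_continuous[OF cont(2)])
  also have "\<dots> = integral (cbox c d) (\<lambda>y. integral (cbox a b) (\<lambda>x. px k (x, y)))"
    by (rule integral_swap_continuous[OF cont(1)])
  also have "\<dots> = integral (cbox c d) (\<lambda>y. 0)"
  proof (intro Henstock_Kurzweil_Integration.integral_cong)
    fix y
    have "((\<lambda>x. px k (x, y)) has_integral (k (b, y) - k (a, y))) {a..b}"
      using k by (intro fundamental_theorem_of_calculus ab has_vector_derivative_px) (auto simp: c1_def)
    then show "integral (cbox a b) (\<lambda>x. px k (x, y)) = 0"
      by (simp add: z integral_unique)
  qed
  finally show ?thesis by simp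
qed

lemma integral_py_eq_0:
  fixes k :: "real \<times> real \<Rightarrow> real"
  assumes k: "c1 UNIV k" and z: "\<And>x y. y \<in> {c, d} \<Longrightarrow> k (x, y) = 0" and cd: "c \<le> d"
  shows "integral (cbox (a, c) (b, d)) (py k) = 0"
proof -
  have cont: "continuous_on S (py k)" for S
    using k by (auto simp: c1_def intro: continuous_on_subset)
  have "integral (cbox (a, c) (b, d)) (py k) = integral (cbox a b) (\<lambda>x. integral (cbox c d) (\<lambda>y. py k (x, y)))"
    by (rule integral_prod_continuous[OF cont])
  also have "\<dots> = integral (cbox a b) (\<lambda>y. 0)"
  proof (intro Henstock_Kurzweil_Integration.integral_cong)
    fix x
    have "((\<lambda>y. py k (x, y)) has_integral (k (x, d) - k (x, c))) {c..d}"
      using k by (intro fundamental_theorem_of_calculus cd has_vector_derivative_py) (auto simp: c1_def)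
    then show "integral (cbox c d) (\<lambda>y. py k (x, y)) = 0"
      by (simp add: z integral_unique)
  qed
  finally show ?thesis by simp
qed

lemma integral_eq_if_vanishing_outside:
  fixes f :: "'n::euclidean_space \<Rightarrow> 'a::banach"
  assumes "\<And>x. x \<notin> S \<inter> T \<Longrightarrow> f x = 0"
  shows "integral S f = integral T f"
proof -
  have "(\<lambda>x. if x \<in> S then f x else 0) = (\<lambda>x. if x \<in> T then f x else 0)"
    using assms by auto
  then show ?thesis by (metis integral_restrict_UNIV)
qed

lemma
  assumes "f differentiable (at (z + s))"
  shows has_derivative_shift: "((\<lambda>z. f (z + s)) has_derivative
      (\<lambda>k. fst k *\<^sub>R px f (z + s) + snd k *\<^sub>R py f (z + s))) (at z)"
    and px_shift: "px (\<lambda>z. f (z + s)) z = px f (z + s)"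
    and py_shift: "py (\<lambda>z. f (z + s)) z = py f (z + s)"
proof -
  have "((\<lambda>z. z + s) has_derivative (\<lambda>k. k)) (at z)"
    by (auto intro!: derivative_eq_intros)
  from diff_chain_at[OF this differentiable_has_derivative[OF assms]]
  show d: "((\<lambda>z. f (z + s)) has_derivative
      (\<lambda>k. fst k *\<^sub>R px f (z + s) + snd k *\<^sub>R py f (z + s))) (at z)"
    by (simp add: o_def)
  show "px (\<lambda>z. f (z + s)) z = px f (z + s)" "py (\<lambda>z. f (z + s)) z = py f (z + s)"
    using d by (simp_all add: has_derivative_px has_derivative_py)
qed

lemma c1_shift:
  assumes "c1 S f"
  shows "c1 {z. z + s \<in> S} (\<lambda>z. f (z + s))"
proof -
  have *: "continuous_on S (px f)" "continuous_on S (py f)" using assms by (auto simp: c1_def)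
  show ?thesis
    by (rule c1I[OF has_derivative_shift])
      (use assms in \<open>auto simp: c1_def intro!: continuous_on_compose2[OF *(1)] continuous_on_compose2[OF *(2)] continuous_intros\<close>)
qed

text \<open>Both sides are the derivative at 0 of the function sending s to the integral of
  py a z * b (z + (s, 0)): differentiate under the integral sign either as it stands, or after
  integrating by parts in y and shifting a instead of b. This avoids the second derivatives of
  a and b in the usual argument.\<close>

lemma integral_jacobian_eq_0:
  fixes a b :: "real \<times> real \<Rightarrow> real"
  assumes a: "c1 UNIV a" and b: "c1 UNIV b" and M: "0 < M"
    and a0: "\<And>z. z \<notin> cbox (- M, - M) (M, M) \<Longrightarrow> a z = 0"
    and b0: "\<And>z. z \<notin> cbox (- M, - M) (M, M) \<Longrightarrow> b z = 0"
    and N: "N \<ge> M + 2"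
  shows "integral (cbox (- N, - N) (N, N)) (\<lambda>z. px a z * py b z)
       = integral (cbox (- N, - N) (N, N)) (\<lambda>z. py a z * px b z)"
proof -
  define Q where "Q = cbox (- N, - N) (N, N)"
  define K where "K s = integral Q (\<lambda>z. py a z * b (z + (s, 0)))" for s
  have ca: "continuous_on UNIV (px a)" "continuous_on UNIV (py a)" "continuous_on UNIV a"
    and cb: "continuous_on UNIV (px b)" "continuous_on UNIV (py b)" "continuous_on UNIV b"
    using a b c1_continuous_on[OF a] c1_continuous_on[OF b] by (simp_all add: c1_def)
  have open_out: "open (- cbox (- M, - M) (M, M))"
    by (simp add: closed_cbox open_Compl)
  have pb0: "py b z = 0" if "z \<notin> cbox (- M, - M) (M, M)" for z
    using px_cong(2)[OF open_out, of z b "\<lambda>_. 0"] that b0 by (simp add: py_def)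
  note cc = continuous_on_compose2[OF ca(1)] continuous_on_compose2[OF ca(2)] continuous_on_compose2[OF ca(3)]
    continuous_on_compose2[OF cb(1)] continuous_on_compose2[OF cb(2)] continuous_on_compose2[OF cb(3)]
  have K1: "(K has_real_derivative integral Q (\<lambda>z. py a z * px b z)) (at 0)"
  proof -
    have "((\<lambda>s. integral Q (\<lambda>z. py a z * b (z + (s, 0)))) has_field_derivative
        integral Q (\<lambda>z. py a z * px b (z + (0, 0)))) (at 0 within UNIV)"
      unfolding Q_def
    proof (rule leibniz_rule_field_derivative[where fx = "\<lambda>s z. py a z * px b (z + (s, 0))"])
      fix s :: real and z :: "real \<times> real"
      have "((\<lambda>t. b (t, snd z)) has_vector_derivative px b (fst z + s, snd z)) (at (s + fst z))"
        using b by (intro has_vector_derivative_eq_rhs[OF has_vector_derivative_px]) (auto simp: c1_def add.commute)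
      then have "((\<lambda>t. b (t, snd z)) has_real_derivative px b (fst z + s, snd z)) (at (s + fst z))"
        by (simp add: has_real_derivative_iff_has_vector_derivative)
      then have "((\<lambda>t. b (t + fst z, snd z)) has_real_derivative px b (fst z + s, snd z)) (at s)"
        using DERIV_shift[of "\<lambda>t. b (t, snd z)" _ s "fst z"] by (simp add: add.commute)
      then have "((\<lambda>s. py a z * b (s + fst z, snd z)) has_real_derivative
          (py a z * px b (fst z + s, snd z))) (at s)"
        by (auto intro!: derivative_eq_intros)
      moreover have "z + (t, 0) = (t + fst z, snd z)" for t by (simp add: prod_eq_iff)
      ultimately show "((\<lambda>s. py a z * b (z + (s, 0))) has_real_derivative py a z * px b (z + (s, 0))) (at s within UNIV)"
        by (simp add: add.commute)
    qed (auto intro!: integrable_continuous continuous_intros cc simp: split_beta)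
    then show ?thesis by (simp add: K_def[abs_def] flip: zero_prod_def)
  qed
  \<comment> \<open>Integration by parts in y moves the derivative onto b, and a translation then
    moves the shift onto a. For |s| < 1 the margin in \<open>N\<close> keeps the support of a inside
    the translated square, so changing the square costs nothing.\<close>
  have K2': "K s = - integral Q (\<lambda>z. a (z + (- s, 0)) * py b z)" if s: "\<bar>s\<bar> < 1" for s
  proof -
    have i: "(\<lambda>z. py a z * b (z + (s, 0))) integrable_on Q" "(\<lambda>z. a z * py b (z + (s, 0))) integrable_on Q"
      unfolding Q_def by (auto intro!: integrable_continuous continuous_intros cc)
    have bs: "c1 UNIV (\<lambda>z. b (z + (s, 0)))" using c1_shift[OF b, of "(s, 0)"] by simp
    have "integral Q (py (\<lambda>z. a z * b (z + (s, 0)))) = 0"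
      unfolding Q_def
    proof (rule integral_py_eq_0)
      show "c1 UNIV (\<lambda>z. a z * b (z + (s, 0)))" by (rule c1_mult[OF a bs])
      fix x y :: real assume "y \<in> {- N, N}"
      then show "a (x, y) * b ((x, y) + (s, 0)) = 0" using N M a0[of "(x, y)"] by auto
    qed (use N M in simp)
    also have "py (\<lambda>z. a z * b (z + (s, 0))) = (\<lambda>z. a z * py b (z + (s, 0)) + py a z * b (z + (s, 0)))"
      using a b bs py_mult[of a _ "\<lambda>z. b (z + (s, 0))"] by (auto simp: c1_def py_shift)
    finally have "K s = - integral Q (\<lambda>z. a z * py b (z + (s, 0)))"
      unfolding K_def using i by (subst (asm) Henstock_Kurzweil_Integration.integral_add) auto
    also have "integral Q (\<lambda>z. a z * py b (z + (s, 0)))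
        = integral (cbox (- N - s, - N) (N - s, N)) (\<lambda>z. a z * py b (z + (s, 0)))"
    proof (rule integral_eq_if_vanishing_outside)
      fix z assume "z \<notin> Q \<inter> cbox (- N - s, - N) (N - s, N)"
      then have "z \<notin> cbox (- M, - M) (M, M)" using N s by (auto simp: Q_def cbox_Pair_eq)
      then show "a z * py b (z + (s, 0)) = 0" using a0 by simp
    qed
    also have "\<dots> = integral (cbox ((- N, - N) - (s, 0)) ((N, N) - (s, 0))) (\<lambda>z. a z * py b (z + (s, 0)))"
      by simp
    also have "\<dots> = integral Q (\<lambda>z. a (z + (- s, 0)) * py b z)"
      using integral_shift_cbox[of "(- N, - N)" "(s, 0)" "(N, N)" "\<lambda>z. a (z + (- s, 0)) * py b z"]
      by (simp add: Q_def add.assoc flip: zero_prod_def)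
    finally show ?thesis .
  qed
  have K2: "(K has_real_derivative integral Q (\<lambda>z. px a z * py b z)) (at 0)"
  proof -
    have "((\<lambda>s. integral Q (\<lambda>z. - (a (z + (- s, 0)) * py b z))) has_field_derivative
        integral Q (\<lambda>z. px a (z + (- 0, 0)) * py b z)) (at 0 within UNIV)"
      unfolding Q_def
    proof (rule leibniz_rule_field_derivative[where fx = "\<lambda>s z. px a (z + (- s, 0)) * py b z"])
      fix s :: real and z :: "real \<times> real"
      have "((\<lambda>t. a (t, snd z)) has_vector_derivative px a (fst z - s, snd z)) (at (fst z - s))"
        using a by (intro has_vector_derivative_eq_rhs[OF has_vector_derivative_px]) (auto simp: c1_def)
      then have "((\<lambda>t. a (t, snd z)) has_real_derivative px a (fst z - s, snd z)) (at (fst z - s))"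
        by (simp add: has_real_derivative_iff_has_vector_derivative)
      moreover have "((\<lambda>s. fst z - s) has_real_derivative -1) (at s)"
        by (auto intro!: derivative_eq_intros)
      ultimately have "((\<lambda>s. a (fst z - s, snd z)) has_real_derivative px a (fst z - s, snd z) * (-1)) (at s)"
        by (rule DERIV_chain2)
      then have "((\<lambda>s. - (a (fst z - s, snd z) * py b z)) has_real_derivative
          (px a (fst z - s, snd z) * py b z)) (at s)"
        by (auto intro!: derivative_eq_intros)
      moreover have "z + (- t, 0) = (fst z - t, snd z)" for t by (simp add: prod_eq_iff)
      ultimately show "((\<lambda>s. - (a (z + (- s, 0)) * py b z)) has_real_derivative px a (z + (- s, 0)) * py b z) (at s within UNIV)"
        by simp
    qed (auto intro!: integrable_continuous continuous_intros cc simp: split_beta)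
    then have "((\<lambda>s. - integral Q (\<lambda>z. a (z + (- s, 0)) * py b z)) has_real_derivative
        integral Q (\<lambda>z. px a z * py b z)) (at 0)"
      by (simp flip: zero_prod_def)
    then show ?thesis
      by (rule has_field_derivative_transform_within[where d = 1]) (use K2' in \<open>auto simp: dist_real_def\<close>)
  qed
  show ?thesis using DERIV_unique[OF K1 K2] unfolding Q_def by simp
qed

section \<open>A Poincare inequality for the Cauchy-Riemann operator\<close>

text \<open>Twice the Wirtinger derivative with respect to the conjugate of zeta = x + i y, hence
  zero on holomorphic functions of zeta.\<close>

definition dbar :: "(real \<times> real \<Rightarrow> complex) \<Rightarrow> real \<times> real \<Rightarrow> complex" where
  "dbar f z = px f z + \<i> * py f z"

lemma continuous_on_dbar: "c1 S f \<Longrightarrow> continuous_on S (dbar f)"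
  unfolding dbar_def[abs_def] c1_def by (auto intro!: continuous_intros)

lemma dbar_mult:
  assumes "f differentiable (at z)" "g differentiable (at z)"
  shows "dbar (\<lambda>w. f w * g w) z = f z * dbar g z + dbar f z * g z"
  by (simp add: dbar_def px_mult[OF assms] py_mult[OF assms] algebra_simps)

lemma dbar_cong:
  "open S \<Longrightarrow> z \<in> S \<Longrightarrow> (\<And>w. w \<in> S \<Longrightarrow> f w = g w) \<Longrightarrow> dbar f z = dbar g z"
  by (simp add: dbar_def px_cong[of S z f g])

lemma dbar_const [simp]: "dbar (\<lambda>z. c) z = 0"
  by (simp add: dbar_def px_def py_def)

text \<open>For G = a + i b, |dbar G|^2 is |grad a|^2 + |grad b|^2 minus twice the Jacobian of (a,
  b), whose integral is 0. So dbar G alone controls G_x in the mean square, and a one-dimensional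
  Poincare inequality in x does the rest.\<close>

lemma poincare_dbar:
  fixes G :: "real \<times> real \<Rightarrow> complex"
  assumes G: "c1 UNIV G" and R: "0 < R"
    and G0: "\<And>z. z \<notin> cbox (- R, - R) (R, R) \<Longrightarrow> G z = 0"
    and N: "N \<ge> R + 2"
  defines "Q \<equiv> cbox (- N, - N) (N, N)"
  shows "integral Q (\<lambda>z. (norm (G z))\<^sup>2) \<le> 4 * R\<^sup>2 * integral Q (\<lambda>z. (norm (dbar G z))\<^sup>2)"
proof -
  define a where "a z = Re (G z)" for z
  define b where "b z = Im (G z)" for z
  have dG: "G differentiable (at z)" for z using c1_differentiable[OF G] by simp
  have a: "c1 UNIV a" and b: "c1 UNIV b"
    unfolding a_def[abs_def] b_def[abs_def]
    by (auto intro!: c1_bounded_linear[OF bounded_linear_Re] c1_bounded_linear[OF bounded_linear_Im] G)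
  have pa: "px a z = Re (px G z)" "py a z = Re (py G z)" for z
    using px_bounded_linear[OF bounded_linear_Re dG] by (simp_all add: a_def[abs_def])
  have pb: "px b z = Im (px G z)" "py b z = Im (py G z)" for z
    using px_bounded_linear[OF bounded_linear_Im dG] by (simp_all add: b_def[abs_def])
  have a0: "a z = 0" and b0: "b z = 0" if "z \<notin> cbox (- R, - R) (R, R)" for z
    using G0[OF that] by (simp_all add: a_def b_def)
  have cont: "continuous_on S a" "continuous_on S b" "continuous_on S (px a)" "continuous_on S (py a)"
    "continuous_on S (px b)" "continuous_on S (py b)" "continuous_on S G" "continuous_on S (dbar G)" for S
    using c1_subset[OF a, of S] c1_subset[OF b, of S] c1_subset[OF G, of S]
    by (auto simp: c1_continuous_on continuous_on_dbar) (auto simp: c1_def)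
  \<comment> \<open>The multiplier x |G|^2: its x-derivative contains |G|^2, yet integrates to 0
    because k vanishes on the vertical sides.\<close>
  define k where "k z = fst z * (a z * a z + b z * b z)" for z
  have "c1 UNIV fst"
    by (rule c1I[where fx = "\<lambda>_. 1" and fy = "\<lambda>_. 0"]) (auto intro!: derivative_eq_intros)
  have k: "c1 UNIV k"
  proof -
    have "c1 UNIV (\<lambda>z. a z * a z - (- 1) * (b z * b z))"
      by (intro c1_diff c1_mult a b c1_const)
    then show ?thesis unfolding k_def[abs_def]
      by (intro c1_mult[OF \<open>c1 UNIV fst\<close>]) simp
  qed
  have pk: "px k z = (a z)\<^sup>2 + (b z)\<^sup>2 + 2 * fst z * (a z * px a z + b z * px b z)" for z
  proof -
    have "(k has_derivative (\<lambda>h. fst z * ((a z * (fst h * px a z + snd h * py a z) + (fst h * px a z + snd h * py a z) * a z)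
        + (b z * (fst h * px b z + snd h * py b z) + (fst h * px b z + snd h * py b z) * b z))
        + fst h * (a z * a z + b z * b z))) (at z)"
      unfolding k_def[abs_def] using c1D[OF a UNIV_I, of z] c1D[OF b UNIV_I, of z]
      by (auto intro!: derivative_eq_intros)
    from has_derivative_px[OF this] show ?thesis by (simp add: power2_eq_square algebra_simps)
  qed
  define J where "J z = px a z * py b z - py a z * px b z" for z
  have main: "(norm (G z))\<^sup>2 \<le> 2 * px k z + 4 * R\<^sup>2 * (norm (dbar G z))\<^sup>2 + 8 * R\<^sup>2 * J z" for z
  proof -
    have D: "(norm (dbar G z))\<^sup>2 = (px a z - py b z)\<^sup>2 + (px b z + py a z)\<^sup>2"
      by (simp add: cmod_power2 dbar_def pa pb)
    have "(px a z)\<^sup>2 + (px b z)\<^sup>2 \<le> (norm (dbar G z))\<^sup>2 + 2 * J z"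
      unfolding D J_def by (simp add: power2_eq_square algebra_simps)
    then have 1: "4 * R\<^sup>2 * ((px a z)\<^sup>2 + (px b z)\<^sup>2) \<le> 4 * R\<^sup>2 * (norm (dbar G z))\<^sup>2 + 8 * R\<^sup>2 * J z"
      using mult_left_mono[of "(px a z)\<^sup>2 + (px b z)\<^sup>2" "(norm (dbar G z))\<^sup>2 + 2 * J z" "4 * R\<^sup>2"]
      by (simp add: algebra_simps)
    have n: "(norm (G z))\<^sup>2 = (a z)\<^sup>2 + (b z)\<^sup>2"
      by (simp add: cmod_power2 a_def b_def)
    have "(a z)\<^sup>2 + (b z)\<^sup>2 \<le> 2 * px k z + 4 * R\<^sup>2 * ((px a z)\<^sup>2 + (px b z)\<^sup>2)"
    proof (cases "z \<in> cbox (- R, - R) (R, R)")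
      case False
      then show ?thesis using a0 b0 by (simp add: pk)
    next
      case True
      then have "\<bar>fst z\<bar> \<le> R" by (auto simp: cbox_Pair_eq)
      then have "(fst z)\<^sup>2 \<le> R\<^sup>2" using R by (metis abs_le_square_iff abs_of_pos)
      then have "(fst z)\<^sup>2 * ((px a z)\<^sup>2 + (px b z)\<^sup>2) \<le> R\<^sup>2 * ((px a z)\<^sup>2 + (px b z)\<^sup>2)"
        by (intro mult_right_mono) auto
      \<comment> \<open>This sum of squares equals 2 px k - |G|^2 + 4 x^2 |G_x|^2; the constants 2
        and 4 R^2 come from here.\<close>
      moreover have "0 \<le> (a z + 2 * fst z * px a z)\<^sup>2 + (b z + 2 * fst z * px b z)\<^sup>2" by simp
      ultimately show ?thesis by (simp add: pk power2_eq_square algebra_simps)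
    qed
    then show ?thesis using 1 n by linarith
  qed
  have ck: "continuous_on S (px k)" for S using k by (auto simp: c1_def intro: continuous_on_subset)
  have i: "(\<lambda>z. (norm (G z))\<^sup>2) integrable_on Q" "px k integrable_on Q" "(\<lambda>z. (norm (dbar G z))\<^sup>2) integrable_on Q"
    "J integrable_on Q" "(\<lambda>z. px a z * py b z) integrable_on Q" "(\<lambda>z. py a z * px b z) integrable_on Q"
    unfolding Q_def J_def[abs_def]
    by (intro integrable_continuous continuous_intros cont ck)+
  have "integral Q (px k) = 0"
    unfolding Q_def
  proof (rule integral_px_eq_0[OF k])
    fix x y assume "x \<in> {- N, N}"
    then show "k (x, y) = 0" using N R a0[of "(x, y)"] b0[of "(x, y)"] by (auto simp: k_def)
  qed (use N R in simp)
  moreover have "integral Q J = 0"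
    using integral_jacobian_eq_0[OF a b R a0 b0 N] i(5,6)
    unfolding J_def[abs_def] Q_def by (subst Henstock_Kurzweil_Integration.integral_diff) auto
  moreover have "((\<lambda>z. 2 * px k z + 4 * R\<^sup>2 * (norm (dbar G z))\<^sup>2 + 8 * R\<^sup>2 * J z) has_integral
      2 * integral Q (px k) + 4 * R\<^sup>2 * integral Q (\<lambda>z. (norm (dbar G z))\<^sup>2) + 8 * R\<^sup>2 * integral Q J) Q"
    by (intro has_integral_add has_integral_mult_right integrable_integral i)
  then have "integral Q (\<lambda>z. (norm (G z))\<^sup>2) \<le>
      2 * integral Q (px k) + 4 * R\<^sup>2 * integral Q (\<lambda>z. (norm (dbar G z))\<^sup>2) + 8 * R\<^sup>2 * integral Q J"
    by (rule has_integral_le[OF integrable_integral[OF i(1)] _ main])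
  ultimately show ?thesis by simp
qed

section \<open>C^1 cutoffs and the holomorphic weight\<close>

lemma has_real_derivative_max_square:
  "((\<lambda>t. (max 0 t)\<^sup>2) has_real_derivative 2 * max 0 t) (at t)"
proof -
  consider "t < 0" | "t > 0" | "t = 0" by linarith
  then show ?thesis
  proof cases
    case 1
    have "((\<lambda>t. 0) has_real_derivative 2 * max 0 t) (at t)" using 1 by simp
    then show ?thesis
      by (rule has_field_derivative_transform_within_open[of _ _ _ "{..<0}"]) (use 1 in auto)
  next
    case 2
    have "((\<lambda>t. t\<^sup>2) has_real_derivative 2 * max 0 t) (at t)"
      using 2 by (auto intro!: derivative_eq_intros)
    then show ?thesis
      by (rule has_field_derivative_transform_within_open[of _ _ _ "{0<..}"]) (use 2 in auto)
  next
    case 3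
    have "((\<lambda>h::real. (max 0 h)\<^sup>2 / h) \<longlongrightarrow> 0) (at 0)"
    proof (rule Lim_null_comparison)
      show "\<forall>\<^sub>F h in at 0. norm ((max 0 h)\<^sup>2 / h) \<le> \<bar>h\<bar>"
        by (rule always_eventually) (auto simp: max_def power2_eq_square)
      show "((\<lambda>h. \<bar>h\<bar>) \<longlongrightarrow> (0::real)) (at 0)"
        by (auto intro!: tendsto_eq_intros)
    qed
    then show ?thesis using 3 by (simp add: DERIV_def)
  qed
qed

text \<open>The square of the positive part is a sufficiently regular building block, and H(b - t) /
  (H(b - t) + H(t - a)) has the required shape. The denominator is positive because a < b forces t <
  b or t > a.\<close>

lemma smooth_step:
  fixes a b :: real
  assumes "a < b"
  obtains s s' where "\<And>t. (s has_real_derivative s' t) (at t)" "continuous_on UNIV s'"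
    "\<And>t. t \<le> a \<Longrightarrow> s t = 1" "\<And>t. t \<ge> b \<Longrightarrow> s t = 0"
proof -
  define H :: "real \<Rightarrow> real" where "H t = (max 0 t)\<^sup>2" for t
  define d where "d t = H (b - t) + H (t - a)" for t
  have dpos: "d t > 0" for t
  proof -
    have "H (b - t) > 0 \<or> H (t - a) > 0" using assms by (auto simp: H_def max_def)
    moreover have "H x \<ge> 0" for x by (simp add: H_def)
    ultimately show ?thesis unfolding d_def by (meson add_pos_nonneg add_nonneg_pos)
  qed
  have H: "(H has_real_derivative 2 * max 0 t) (at t)" for t
    unfolding H_def[abs_def] by (rule has_real_derivative_max_square)
  have H1: "((\<lambda>t. H (b - t)) has_real_derivative - (2 * max 0 (b - t))) (at t)" for t
  proof -
    have "((\<lambda>t. b - t) has_real_derivative - 1) (at t)" by (auto intro!: derivative_eq_intros)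
    from DERIV_chain2[OF H this] show ?thesis by simp
  qed
  have H2: "((\<lambda>t. H (t - a)) has_real_derivative 2 * max 0 (t - a)) (at t)" for t
  proof -
    have "((\<lambda>t. t - a) has_real_derivative 1) (at t)" by (auto intro!: derivative_eq_intros)
    from DERIV_chain2[OF H this] show ?thesis by simp
  qed
  have cH: "continuous_on UNIV H"
    unfolding H_def[abs_def] by (intro continuous_intros)
  note cH' = continuous_on_compose2[OF cH]
  show thesis
  proof (rule that)
    fix t
    show "((\<lambda>t. H (b - t) / d t) has_real_derivative
      ((- (2 * max 0 (b - t))) * d t - H (b - t) * (- (2 * max 0 (b - t)) + 2 * max 0 (t - a))) / (d t * d t)) (at t)"
      using dpos[of t] unfolding d_def by (intro DERIV_divide DERIV_add H1 H2) auto
    have "d t \<noteq> 0" using dpos[of t] by simp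
    then show "t \<le> a \<Longrightarrow> H (b - t) / d t = 1" "t \<ge> b \<Longrightarrow> H (b - t) / d t = 0"
      by (auto simp: d_def H_def)
  next
    have "continuous_on UNIV d" unfolding d_def[abs_def] by (intro continuous_intros cH') auto
    then show "continuous_on UNIV (\<lambda>t. ((- (2 * max 0 (b - t))) * d t
        - H (b - t) * (- (2 * max 0 (b - t)) + 2 * max 0 (t - a))) / (d t * d t))"
      using dpos by (intro continuous_intros cH') (auto simp: less_imp_neq[THEN not_sym])
  qed
qed

lemma norm_Complex_pair: "cmod (Complex (fst z) (snd z)) = norm (z :: real \<times> real)"
  by (cases z) (simp add: cmod_def norm_prod_def)

text \<open>The step is composed with the squared norm, a polynomial, since the norm itself is not
  differentiable at the origin. Complex values allow the cutoff to multiply f and w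
  directly.\<close>

lemma radial_cutoff:
  assumes "0 < r" "r < R"
  obtains h :: "real \<times> real \<Rightarrow> complex" where "c1 UNIV h"
    "\<And>z. norm z \<le> r \<Longrightarrow> h z = 1" "\<And>z. norm z \<ge> R \<Longrightarrow> h z = 0"
proof -
  have "r\<^sup>2 < R\<^sup>2" using assms by (intro power_strict_mono) auto
  then obtain s s' where s: "\<And>t. (s has_real_derivative s' t) (at t)" "continuous_on UNIV s'"
    "\<And>t. t \<le> r\<^sup>2 \<Longrightarrow> s t = 1" "\<And>t. t \<ge> R\<^sup>2 \<Longrightarrow> s t = 0"
    by (rule smooth_step) (rule that)
  define q where "q z = (fst z)\<^sup>2 + (snd z)\<^sup>2" for z :: "real \<times> real"
  have q: "q z = (norm z)\<^sup>2" for z by (cases z) (simp add: q_def norm_prod_def)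
  have cs: "continuous_on UNIV (\<lambda>z. s' (q z))"
    unfolding q_def by (intro continuous_on_compose2[OF s(2)] continuous_intros) auto
  have c: "c1 UNIV (\<lambda>z. s (q z))"
  proof (rule c1I)
    fix z
    have "(q has_derivative (\<lambda>k. 2 * fst z * fst k + 2 * snd z * snd k)) (at z)"
      unfolding q_def[abs_def] by (auto intro!: derivative_eq_intros)
    from has_derivative_compose[OF this s(1)[of "q z", unfolded has_field_derivative_def]]
    show "((\<lambda>z. s (q z)) has_derivative
        (\<lambda>k. fst k *\<^sub>R (s' (q z) * (2 * fst z)) + snd k *\<^sub>R (s' (q z) * (2 * snd z)))) (at z)"
      by (simp add: algebra_simps)
  qed (intro continuous_intros cs)+
  show thesis
  proof (rule that)
    show "c1 UNIV (\<lambda>z. of_real (s (q z)) :: complex)"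
      by (rule c1_bounded_linear[OF bounded_linear_of_real c])
    show "of_real (s (q z)) = (1::complex)" if "norm z \<le> r" for z
      using that assms by (simp add: q s(3) power_mono)
    show "of_real (s (q z)) = (0::complex)" if "norm z \<ge> R" for z
      using that assms by (simp add: q s(4) power_mono)
  qed
qed

text \<open>A holomorphic function of zeta has a complex linear derivative, so py is i times px, and
  px + i py cancels.\<close>

lemma
  fixes r :: real
  defines "q \<equiv> \<lambda>(n::nat) z. (of_real r / Complex (fst z) (snd z)) ^ n"
  shows c1_inverse_power: "c1 (- {0}) (q n)"
    and dbar_inverse_power: "z \<noteq> 0 \<Longrightarrow> dbar (q n) z = 0"
proof -
  \<comment> \<open>For n = 0 the truncated exponent n - 1 is harmless, because the factor
    \<open>of_nat n\<close> is 0.\<close>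
  define q' where "q' u = (of_nat n * (of_real r / u) ^ (n - 1) * (- of_real r / u\<^sup>2) :: complex)" for u
  define \<zeta> where "\<zeta> z = Complex (fst z) (snd z)" for z :: "real \<times> real"
  have z0: "\<zeta> z \<noteq> 0" if "z \<noteq> 0" for z using that norm_Complex_pair[of z] by (auto simp: \<zeta>_def)
  have \<zeta>: "(\<zeta> has_derivative \<zeta>) (at z)" for z
  proof -
    have "bounded_linear \<zeta>"
      by (rule bounded_linear_intro[where K = 1])
        (simp_all add: \<zeta>_def norm_Complex_pair complex_eq_iff)
    then show ?thesis by (rule bounded_linear_imp_has_derivative)
  qed
  have d: "(q n has_derivative (\<lambda>k. fst k *\<^sub>R q' (\<zeta> z) + snd k *\<^sub>R (\<i> * q' (\<zeta> z)))) (at z)" if "z \<noteq> 0" for z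
  proof -
    have "((\<lambda>u. (of_real r / u) ^ n) has_field_derivative q' (\<zeta> z)) (at (\<zeta> z))"
      using z0[OF that] unfolding q'_def
      by (auto intro!: derivative_eq_intros simp: power2_eq_square)
    from has_derivative_compose[OF \<zeta> this[unfolded has_field_derivative_def]]
    have "(q n has_derivative (\<lambda>k. q' (\<zeta> z) * \<zeta> k)) (at z)"
      by (simp add: q_def \<zeta>_def[abs_def])
    moreover have "q' (\<zeta> z) * \<zeta> k = fst k *\<^sub>R q' (\<zeta> z) + snd k *\<^sub>R (\<i> * q' (\<zeta> z))" for k
      by (simp add: \<zeta>_def complex_eq_iff algebra_simps)
    ultimately show ?thesis by simp
  qed
  have c: "continuous_on (- {0}) (\<lambda>z. q' (\<zeta> z))"
  proof -
    have "continuous_on UNIV \<zeta>"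
      using \<zeta> by (auto intro!: has_derivative_continuous continuous_at_imp_continuous_on)
    then have "continuous_on (- {0}) \<zeta>" by (rule continuous_on_subset) auto
    then show ?thesis unfolding q'_def by (intro continuous_intros) (auto simp: z0)
  qed
  show "c1 (- {0}) (q n)" by (rule c1I[OF d]) (auto intro!: continuous_intros c)
  show "dbar (q n) z = 0" if "z \<noteq> 0"
    unfolding dbar_def has_derivative_px[OF d[OF that]] has_derivative_py[OF d[OF that]] by simp
qed

section \<open>Unique continuation\<close>

lemma norm_sum_square_le: "(cmod (u + v))\<^sup>2 \<le> 2 * (cmod u)\<^sup>2 + 2 * (cmod v)\<^sup>2"
proof -
  have "(cmod (u + v))\<^sup>2 \<le> (cmod u + cmod v)\<^sup>2"
    by (intro power_mono norm_triangle_ineq) auto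
  also have "\<dots> \<le> 2 * (cmod u)\<^sup>2 + 2 * (cmod v)\<^sup>2"
    using zero_le_power2[of "cmod u - cmod v"] by (simp add: power2_eq_square algebra_simps)
  finally show ?thesis .
qed

text \<open>The weight is singular at 0 and f is uncontrolled outside S; the zeros of f near 0 and
  of h beyond R allow continuation by 0. Three open regions cover the plane: the punctured S, where
  the product rule applies, and two regions where G is 0. As dbar of the weight is 0, the weight
  enters dbar G only as a factor.\<close>

lemma carleman_weighted:
  fixes f :: "real \<times> real \<Rightarrow> complex" and r :: real and n :: nat
  assumes f: "c1 S f" and S: "open S" "cball 0 R \<subseteq> S"
    and s: "0 < s" "s < R" and f0: "\<And>z. z \<in> ball 0 s \<Longrightarrow> f z = 0"
    and h: "c1 UNIV h" "\<And>z. norm z \<ge> R \<Longrightarrow> h z = 0"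
  defines "q \<equiv> \<lambda>z. (of_real r / Complex (fst z) (snd z)) ^ n"
  defines "G \<equiv> \<lambda>z. if z \<in> cball 0 R - ball 0 s then h z * f z * q z else 0"
  shows "c1 UNIV G"
    and "z \<in> cball 0 R - ball 0 s \<Longrightarrow> dbar G z = h z * q z * dbar f z + f z * q z * dbar h z"
    and "z \<notin> cball 0 R - ball 0 s \<Longrightarrow> dbar G z = 0"
proof -
  let ?F = "\<lambda>z. h z * f z * q z"
  have hz: "h z * f z * q z = G z" if "z \<in> S" for z
    using f0[of z] h(2)[of z] by (auto simp: G_def)
  have q: "c1 (- {0}) q" unfolding q_def by (rule c1_inverse_power)
  have oS: "open (S - {0})" using S(1) by (simp add: open_delete)
  have cF: "c1 (S - {0}) ?F"
    by (intro c1_mult c1_subset[OF f] c1_subset[OF q] c1_subset[OF h(1)]) auto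
  then have cG: "c1 (S - {0}) G"
    using c1_cong[OF oS, of G ?F] hz by auto
  have zero: "G z = 0" if "z \<in> ball 0 s \<or> z \<in> - cball 0 R" for z
    using that by (auto simp: G_def)
  have c0: "c1 (ball 0 s) G" "c1 (- cball 0 R) G"
    using c1_cong[of "ball 0 s" G "\<lambda>_. 0"] c1_cong[of "- cball 0 R" G "\<lambda>_. 0"]
    by (auto simp: c1_const zero open_Compl)
  have "UNIV = (S - {0}) \<union> (ball 0 s \<union> - cball 0 R)"
    using S(2) s(1) by auto
  then show "c1 UNIV G"
    using c1_Un[OF oS _ cG c1_Un[OF _ _ c0]] by (simp add: open_Compl open_Un)
  show "dbar G z = 0" if "z \<notin> cball 0 R - ball 0 s"
  proof -
    have "dbar G z = dbar (\<lambda>_. 0) z"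
      by (rule dbar_cong[of "ball 0 s \<union> - cball 0 R"]) (use that zero in \<open>auto simp: open_Compl\<close>)
    then show ?thesis by simp
  qed
  show "dbar G z = h z * q z * dbar f z + f z * q z * dbar h z" if z: "z \<in> cball 0 R - ball 0 s"
  proof -
    have z0: "z \<in> S - {0}" using z s S(2) by auto
    have "dbar G z = dbar ?F z" by (rule dbar_cong[OF oS z0]) (simp add: hz)
    also have "\<dots> = h z * f z * dbar q z + dbar (\<lambda>z. h z * f z) z * q z"
      by (intro dbar_mult c1_differentiable[OF c1_mult[OF c1_subset[OF h(1)] c1_subset[OF f]]]
          c1_differentiable[OF q]) (use z0 in auto)
    also have "dbar (\<lambda>z. h z * f z) z = h z * dbar f z + dbar h z * f z"
      by (intro dbar_mult c1_differentiable[OF h(1)] c1_differentiable[OF f]) (use z0 in auto)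
    also have "dbar q z = 0" unfolding q_def by (rule dbar_inverse_power) (use z0 in auto)
    finally show ?thesis by (simp add: algebra_simps)
  qed
qed

text \<open>Carleman's trick: the weight (r / zeta)^n is holomorphic, so it commutes with dbar, it is
  large exactly where the cutoff is 1, and the singularity at 0 is harmless since f and w vanish
  there. Letting n tend to infinity forces f and w to vanish for |zeta| < r.\<close>

lemma dbar_unique_continuation_disc:
  fixes f w :: "real \<times> real \<Rightarrow> complex"
  assumes f: "c1 S f" and w: "c1 S w" and S: "open S" "cball 0 R \<subseteq> S"
    and s: "0 < s" and zero: "\<And>z. z \<in> ball 0 s \<Longrightarrow> f z = 0 \<and> w z = 0"
    and C: "\<And>z. z \<in> cball 0 R \<Longrightarrow>
        (cmod (dbar f z))\<^sup>2 + (cmod (dbar w z))\<^sup>2 \<le> C * ((cmod (f z))\<^sup>2 + (cmod (w z))\<^sup>2)"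
    and R: "0 < R" "16 * R\<^sup>2 * C \<le> 1"
    and z: "norm z < R / 2"
  shows "f z = 0 \<and> w z = 0"
proof (rule ccontr)
  assume nz: "\<not> (f z = 0 \<and> w z = 0)"
  define r where "r = R / 2"
  have r: "0 < r" "r < R" using R by (auto simp: r_def)
  obtain h :: "real \<times> real \<Rightarrow> complex" where h: "c1 UNIV h"
    "\<And>z. norm z \<le> r \<Longrightarrow> h z = 1" "\<And>z. norm z \<ge> R \<Longrightarrow> h z = 0"
    using radial_cutoff[OF r] by blast
  \<comment> \<open>The disc of zeros may be larger than the disc of radius R;
    \<open>carleman_weighted\<close> asks for a radius below R.\<close>
  define s1 where "s1 = min s r"
  have s1: "0 < s1" "s1 < R" using s r by (auto simp: s1_def)
  have zero1: "f z = 0" "w z = 0" if "z \<in> ball 0 s1" for z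
    using zero[of z] that by (auto simp: s1_def)
  define N where "N = R + 2"
  define Q where "Q = cbox (- N, - N) (N, N :: real)"
  define U where "U z = (cmod (f z))\<^sup>2 + (cmod (w z))\<^sup>2" for z
  define A where "A = cball (0 :: real \<times> real) R - ball 0 s1"
  define q where "q n z = (of_real r / Complex (fst z) (snd z)) ^ n" for n and z :: "real \<times> real"
  define F where "F n = (\<lambda>z. if z \<in> A then h z * f z * q n z else 0)" for n
  define W where "W n = (\<lambda>z. if z \<in> A then h z * w z * q n z else 0)" for n
  define I where "I n = integral Q (\<lambda>z. (cmod (F n z))\<^sup>2 + (cmod (W n z))\<^sup>2)" for n
  have F: "c1 UNIV (F n)"
    "z \<in> A \<Longrightarrow> dbar (F n) z = h z * q n z * dbar f z + f z * q n z * dbar h z"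
    "z \<notin> A \<Longrightarrow> dbar (F n) z = 0" for n z
    unfolding F_def A_def q_def
    by (rule carleman_weighted[OF f S s1 zero1(1) h(1,3)]; assumption)+
  have W: "c1 UNIV (W n)"
    "z \<in> A \<Longrightarrow> dbar (W n) z = h z * q n z * dbar w z + w z * q n z * dbar h z"
    "z \<notin> A \<Longrightarrow> dbar (W n) z = 0" for n z
    unfolding W_def A_def q_def
    by (rule carleman_weighted[OF w S s1 zero1(2) h(1,3)]; assumption)+
  have contU: "continuous_on S U"
    unfolding U_def[abs_def] using c1_continuous_on[OF f] c1_continuous_on[OF w]
    by (auto intro!: continuous_intros)
  \<comment> \<open>This term arises where dbar falls on the cutoff. Stripped of the weight it is
    bounded by a constant \<open>K\<close> that does not depend on n.\<close>
  have "continuous_on (cball 0 R) (\<lambda>z. 2 * (cmod (dbar h z))\<^sup>2 * U z)"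
    using continuous_on_subset[OF contU S(2)] continuous_on_subset[OF continuous_on_dbar[OF h(1)]]
    by (auto intro!: continuous_intros)
  then have "bounded ((\<lambda>z. 2 * (cmod (dbar h z))\<^sup>2 * U z) ` cball 0 R)"
    by (intro compact_imp_bounded compact_continuous_image) auto
  then obtain K where "0 < K" "\<forall>x\<in>(\<lambda>z. 2 * (cmod (dbar h z))\<^sup>2 * U z) ` cball 0 R. norm x \<le> K"
    unfolding bounded_pos by blast
  then have K: "0 < K" "\<And>z. z \<in> cball 0 R \<Longrightarrow> 2 * (cmod (dbar h z))\<^sup>2 * U z \<le> K"
    using abs_le_D1 unfolding real_norm_def by blast+
  have qn: "cmod (q n z) = (r / norm z) ^ n" for n z
    using r(1) by (simp add: q_def norm_power norm_divide norm_Complex_pair)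
  have bound: "(cmod (dbar (F n) z))\<^sup>2 + (cmod (dbar (W n) z))\<^sup>2
      \<le> 2 * C * ((cmod (F n z))\<^sup>2 + (cmod (W n z))\<^sup>2) + K" for n z
  proof (cases "z \<in> A")
    case False
    then show ?thesis using F(3) W(3) K(1) by (simp add: F_def W_def)
  next
    case True
    then have zR: "z \<in> cball 0 R" by (simp add: A_def)
    let ?m = "2 * (cmod (h z * q n z))\<^sup>2"
    have "(cmod (dbar (F n) z))\<^sup>2 + (cmod (dbar (W n) z))\<^sup>2
        \<le> ?m * ((cmod (dbar f z))\<^sup>2 + (cmod (dbar w z))\<^sup>2)
          + 2 * (cmod (dbar h z))\<^sup>2 * U z * (cmod (q n z))\<^sup>2"
      using norm_sum_square_le[of "h z * q n z * dbar f z" "f z * q n z * dbar h z"]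
        norm_sum_square_le[of "h z * q n z * dbar w z" "w z * q n z * dbar h z"]
      unfolding F(2)[OF True] W(2)[OF True] U_def
      by (simp add: norm_mult power_mult_distrib algebra_simps)
    also have "\<dots> \<le> ?m * (C * U z) + K"
    proof (rule add_mono)
      show "?m * ((cmod (dbar f z))\<^sup>2 + (cmod (dbar w z))\<^sup>2) \<le> ?m * (C * U z)"
        using C[OF zR] unfolding U_def by (intro mult_left_mono) auto
      \<comment> \<open>The weight is large only for |zeta| < r, where the cutoff is constant and
        its dbar is 0; elsewhere the weight is at most 1.\<close>
      show "2 * (cmod (dbar h z))\<^sup>2 * U z * (cmod (q n z))\<^sup>2 \<le> K"
      proof (cases "norm z < r")
        case True
        have "dbar h z = dbar (\<lambda>_. 1) z"
          by (rule dbar_cong[of "ball 0 r"]) (use True h(2) in auto)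
        then show ?thesis using K(1) by simp
      next
        case False
        then have "cmod (q n z) \<le> 1" unfolding qn using r(1) by (intro power_le_one) (auto simp: divide_le_eq_1)
        then have "(cmod (q n z))\<^sup>2 \<le> 1" by (intro power_le_one) auto
        moreover have "0 \<le> U z" by (simp add: U_def)
        ultimately have "2 * (cmod (dbar h z))\<^sup>2 * U z * (cmod (q n z))\<^sup>2 \<le> 2 * (cmod (dbar h z))\<^sup>2 * U z"
          by (intro mult_right_le_one_le) auto
        then show ?thesis using K(2)[OF zR] by linarith
      qed
    qed
    also have "?m * (C * U z) = 2 * C * ((cmod (F n z))\<^sup>2 + (cmod (W n z))\<^sup>2)"
      using True by (simp add: F_def W_def U_def norm_mult power_mult_distrib algebra_simps)
    finally show ?thesis .
  qed
  define V where "V = measure lborel Q"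
  have V: "0 \<le> V" by (simp add: V_def)
  have contF: "continuous_on Q (F n)" "continuous_on Q (W n)" "continuous_on Q (dbar (F n))"
    "continuous_on Q (dbar (W n))" for n
    by (auto intro!: continuous_on_subset[OF c1_continuous_on[OF F(1)]] continuous_on_subset[OF c1_continuous_on[OF W(1)]]
        continuous_on_subset[OF continuous_on_dbar[OF F(1)]] continuous_on_subset[OF continuous_on_dbar[OF W(1)]])
  have int: "(\<lambda>z. (cmod (F n z))\<^sup>2) integrable_on Q" "(\<lambda>z. (cmod (W n z))\<^sup>2) integrable_on Q"
    "(\<lambda>z. (cmod (dbar (F n) z))\<^sup>2) integrable_on Q" "(\<lambda>z. (cmod (dbar (W n) z))\<^sup>2) integrable_on Q"
    "(\<lambda>z. (cmod (F n z))\<^sup>2 + (cmod (W n z))\<^sup>2) integrable_on Q" for n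
    unfolding Q_def by (intro integrable_continuous continuous_intros contF[unfolded Q_def])+
  have out: "z \<notin> A" if "z \<notin> cbox (- R, - R) (R, R)" for z :: "real \<times> real"
  proof
    assume "z \<in> A"
    then have "norm z \<le> R" by (simp add: A_def)
    then have "\<bar>fst z\<bar> \<le> R" "\<bar>snd z\<bar> \<le> R"
      using norm_fst_le[of "fst z" "snd z"] norm_snd_le[of "snd z" "fst z"] by auto
    then show False using that by (cases z) (auto simp: cbox_Pair_eq)
  qed
  have upper: "I n \<le> 8 * R\<^sup>2 * K * V" for n
  proof -
    have "I n = integral Q (\<lambda>z. (cmod (F n z))\<^sup>2) + integral Q (\<lambda>z. (cmod (W n z))\<^sup>2)"
      unfolding I_def by (rule Henstock_Kurzweil_Integration.integral_add) (rule int)+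
    also have "\<dots> \<le> 4 * R\<^sup>2 * integral Q (\<lambda>z. (cmod (dbar (F n) z))\<^sup>2)
        + 4 * R\<^sup>2 * integral Q (\<lambda>z. (cmod (dbar (W n) z))\<^sup>2)"
      unfolding Q_def
      by (intro add_mono poincare_dbar F(1) W(1) R(1)) (auto simp: F_def W_def N_def out)
    also have "\<dots> = 4 * R\<^sup>2 * integral Q (\<lambda>z. (cmod (dbar (F n) z))\<^sup>2 + (cmod (dbar (W n) z))\<^sup>2)"
      by (subst Henstock_Kurzweil_Integration.integral_add) (auto simp: int algebra_simps)
    also have "integral Q (\<lambda>z. (cmod (dbar (F n) z))\<^sup>2 + (cmod (dbar (W n) z))\<^sup>2) \<le> 2 * C * I n + K * V"
    proof (rule has_integral_le[OF integrable_integral _ bound])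
      show "(\<lambda>z. (cmod (dbar (F n) z))\<^sup>2 + (cmod (dbar (W n) z))\<^sup>2) integrable_on Q"
        by (intro Henstock_Kurzweil_Integration.integrable_add int)
      have "((\<lambda>z. K) has_integral K * V) Q"
        using has_integral_const[of K "(- N, - N)" "(N, N)"] by (simp add: Q_def V_def mult.commute)
      then show "((\<lambda>z. 2 * C * ((cmod (F n z))\<^sup>2 + (cmod (W n z))\<^sup>2) + K) has_integral 2 * C * I n + K * V) Q"
        unfolding I_def by (intro has_integral_add has_integral_mult_right integrable_integral int)
    qed
    finally have "I n \<le> 8 * R\<^sup>2 * C * I n + 4 * R\<^sup>2 * K * V"
      using R(1) by (simp add: algebra_simps)
    \<comment> \<open>Absorption: the Poincare factor 4 R^2 times 2 C is at most 1/2 by the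
      smallness of R, so this part of the bound moves to the left-hand side.\<close>
    moreover have "8 * R\<^sup>2 * C * I n \<le> 1 / 2 * I n"
    proof (rule mult_right_mono)
      show "0 \<le> I n" unfolding I_def by (intro integral_nonneg int) auto
    qed (use R(2) in simp)
    ultimately show ?thesis by simp
  qed
  have "z \<in> cball 0 R" using z R by simp
  then have zS: "z \<in> S" using S(2) by blast
  have Uz: "U z > 0" using nz by (simp add: U_def sum_power2_gt_zero_iff)
  have "z \<in> ball 0 r" using z by (simp add: r_def)
  have zs1: "norm z \<ge> s1"
    using zero1[of z] nz by (metis mem_ball_0 not_less)
  \<comment> \<open>An intermediate radius makes the growth uniform: on a box around z inside the
    disc of radius \<open>\<rho>\<close>, the squared weight is at least (r /
    \<open>\<rho>\<close>)^(2 n), with a ratio above 1, and \<open>U\<close> stays above half its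
    value at z.\<close>
  obtain \<rho> where \<rho>: "norm z < \<rho>" "\<rho> < r" using z dense r_def by metis
  have \<rho>0: "0 < \<rho>" using \<rho>(1) norm_ge_zero[of z] by linarith
  have "open (ball 0 \<rho> \<inter> {x \<in> S. U x > U z / 2})"
    using continuous_open_preimage[OF contU S(1), of "{U z / 2<..}"]
    by (intro open_Int) (auto simp: vimage_def Int_def)
  moreover have "z \<in> ball 0 \<rho> \<inter> {x \<in> S. U x > U z / 2}"
    using \<rho> zS Uz by simp
  ultimately obtain a b where ab: "cbox a b \<subseteq> ball 0 \<rho> \<inter> {x \<in> S. U x > U z / 2}" "z \<in> box a b"
    using open_contains_cbox[of "ball 0 \<rho> \<inter> {x \<in> S. U x > U z / 2}"] by (metis (no_types, lifting))
  define v where "v = measure lborel (cbox a b)"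
  have v: "v > 0"
    using ab(2) box_ne_empty(2)[of a b] content_pos_lt_eq[of a b] unfolding v_def by blast
  have lower: "(r / \<rho>) ^ (2 * n) * (U z / 2) * v \<le> I n" for n
  proof -
    have sub: "cbox a b \<subseteq> Q"
    proof
      fix x assume "x \<in> cbox a b"
      then have "norm x < R" using ab(1) \<rho> r by auto
      then have "\<bar>fst x\<bar> \<le> R" "\<bar>snd x\<bar> \<le> R"
        using norm_fst_le[of "fst x" "snd x"] norm_snd_le[of "snd x" "fst x"] by auto
      then show "x \<in> Q" by (cases x) (auto simp: Q_def N_def cbox_Pair_eq)
    qed
    have "(r / \<rho>) ^ (2 * n) * (U z / 2) * v = integral (cbox a b) (\<lambda>x. (r / \<rho>) ^ (2 * n) * (U z / 2))"
      by (simp add: v_def)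
    also have "\<dots> \<le> integral (cbox a b) (\<lambda>x. (cmod (F n x))\<^sup>2 + (cmod (W n x))\<^sup>2)"
    proof (rule integral_le)
      show "(\<lambda>x. (r / \<rho>) ^ (2 * n) * (U z / 2)) integrable_on cbox a b"
        by (rule integrable_const)
      show "(\<lambda>x. (cmod (F n x))\<^sup>2 + (cmod (W n x))\<^sup>2) integrable_on cbox a b"
        by (rule integrable_on_subcbox[OF int(5) sub])
      fix x assume x: "x \<in> cbox a b"
      then have xr: "norm x < \<rho>" and xU: "U x > U z / 2" using ab(1) by auto
      have xA: "x \<in> A"
      proof (rule ccontr)
        assume "x \<notin> A"
        then have "x \<in> ball 0 s1" using xr \<rho> r by (auto simp: A_def)
        then have "U x = 0" using zero1 by (simp add: U_def)
        then show False using xU Uz by simp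
      qed
      then have x0: "norm x > 0" using s1 by (auto simp: A_def)
      have "(cmod (F n x))\<^sup>2 + (cmod (W n x))\<^sup>2 = (cmod (q n x))\<^sup>2 * U x"
        using xA h(2)[of x] xr \<rho> by (simp add: F_def W_def U_def norm_mult power_mult_distrib algebra_simps)
      also have "\<dots> = (r / norm x) ^ (2 * n) * U x"
        by (simp add: qn flip: power_mult) (simp add: mult.commute)
      also have "\<dots> \<ge> (r / \<rho>) ^ (2 * n) * (U z / 2)"
        using xr x0 xU Uz r \<rho>0 by (intro mult_mono power_mono divide_left_mono) auto
      finally show "(r / \<rho>) ^ (2 * n) * (U z / 2) \<le> (cmod (F n x))\<^sup>2 + (cmod (W n x))\<^sup>2" .
    qed
    also have "\<dots> \<le> I n"
      unfolding I_def
      by (rule integral_subset_le[OF sub integrable_on_subcbox[OF int(5) sub] int(5)]) auto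
    finally show ?thesis .
  qed
  have "1 < (r / \<rho>)\<^sup>2" using \<rho> \<rho>0 by (simp add: power_one_over one_less_power)
  then obtain n where n: "8 * R\<^sup>2 * K * V / (U z / 2 * v) < ((r / \<rho>)\<^sup>2) ^ n"
    using real_arch_pow by blast
  have "8 * R\<^sup>2 * K * V < (r / \<rho>) ^ (2 * n) * (U z / 2 * v)"
    using n Uz v by (simp add: power_mult pos_divide_less_eq)
  then show False using lower[of n] upper[of n] by (simp add: mult.assoc)
qed

text \<open>The interior of the zero set is open and relatively closed in S. Near a limit point p of
  it, a disc centred at a nearby point of that interior still reaches p. Such a p is a zero of f and
  w by continuity, which is why the differential inequality is demanded only around common
  zeros.\<close>

lemma dbar_unique_continuation:
  fixes f w :: "real \<times> real \<Rightarrow> complex"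
  assumes f: "c1 S f" and w: "c1 S w" and S: "open S" "connected S"
    and C: "\<And>z. z \<in> S \<Longrightarrow> f z = 0 \<Longrightarrow> w z = 0 \<Longrightarrow> \<exists>C. \<exists>e>0. \<forall>x\<in>ball z e.
        (cmod (dbar f x))\<^sup>2 + (cmod (dbar w x))\<^sup>2 \<le> C * ((cmod (f x))\<^sup>2 + (cmod (w x))\<^sup>2)"
    and V: "open V" "V \<noteq> {}" "V \<subseteq> S" "\<And>z. z \<in> V \<Longrightarrow> f z = 0 \<and> w z = 0"
    and z: "z \<in> S"
  shows "f z = 0 \<and> w z = 0"
proof -
  define Z where "Z = interior {z \<in> S. f z = 0 \<and> w z = 0}"
  have ZS: "Z \<subseteq> {z \<in> S. f z = 0 \<and> w z = 0}" unfolding Z_def by (rule interior_subset)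
  have step: "p \<in> Z" if p: "p \<in> S" "p \<in> closure Z" for p
  proof -
    have "continuous_on S (\<lambda>z. (cmod (f z))\<^sup>2 + (cmod (w z))\<^sup>2)"
      by (intro continuous_intros c1_continuous_on[OF f] c1_continuous_on[OF w])
    then have "closedin (top_of_set S) {z \<in> S. (cmod (f z))\<^sup>2 + (cmod (w z))\<^sup>2 = 0}"
      by (rule continuous_closedin_preimage_constant)
    moreover have "{z \<in> S. (cmod (f z))\<^sup>2 + (cmod (w z))\<^sup>2 = 0} = {z \<in> S. f z = 0 \<and> w z = 0}"
      by (auto simp: add_nonneg_eq_0_iff)
    ultimately obtain T where T: "closed T" "{z \<in> S. f z = 0 \<and> w z = 0} = S \<inter> T"
      by (auto simp: closedin_closed)
    then have "p \<in> T" using p(2) ZS closure_minimal[of Z T] by blast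
    then have p0: "f p = 0" "w p = 0" using T(2) p(1) by auto
    obtain C e where e: "e > 0" and C: "\<And>x. x \<in> ball p e \<Longrightarrow>
        (cmod (dbar f x))\<^sup>2 + (cmod (dbar w x))\<^sup>2 \<le> C * ((cmod (f x))\<^sup>2 + (cmod (w x))\<^sup>2)"
      using C[OF p(1) p0] by blast
    \<comment> \<open>Enlarging the constant keeps the bound and makes its square root positive, as
      needed for the division below.\<close>
    define C' where "C' = max C 1"
    obtain d where d: "d > 0" "ball p d \<subseteq> S" using S(1) p(1) open_contains_ball by blast
    \<comment> \<open>A disc of radius R around a point closer than R/2 to p lies within 2 R of p,
      hence in both balls; the last entry gives 4 R sqrt C' <= 1, that is 16 R^2 C' <= 1.\<close>
    define R where "R = min (min (e / 2) (d / 2)) (1 / (4 * sqrt C')) / 2"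
    have "C' > 0" by (simp add: C'_def)
    have "0 < R" using e d \<open>C' > 0\<close> by (auto simp: R_def)
    have R: "R < e / 2" "R < d / 2" using \<open>0 < R\<close> e d by (auto simp: R_def)
    have "16 * R\<^sup>2 * C' \<le> 1"
    proof -
      have "2 * R \<le> 1 / (4 * sqrt C')" by (simp add: R_def)
      then have "R \<le> 1 / (4 * sqrt C')" using \<open>0 < R\<close> by linarith
      then have "4 * R * sqrt C' \<le> 1" using \<open>C' > 0\<close> by (simp add: field_simps)
      then have "(4 * R * sqrt C')\<^sup>2 \<le> 1" using \<open>0 < R\<close> \<open>C' > 0\<close> by (intro power_le_one) auto
      then show ?thesis using \<open>C' > 0\<close> by (simp add: power_mult_distrib)
    qed
    obtain a where a: "a \<in> Z" "dist a p < R / 2"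
      using p(2) \<open>0 < R\<close> by (metis closure_approachable half_gt_zero)
    obtain s where s: "s > 0" "ball a s \<subseteq> Z"
      using a(1) open_contains_ball[of Z] by (auto simp: Z_def)
    have sub: "x + a \<in> ball p e \<inter> S" if "norm x \<le> R" for x
    proof -
      have "dist (x + a) p \<le> norm x + dist a p"
        using dist_triangle[of "x + a" p a] by (simp add: dist_norm)
      then have "dist (x + a) p < 2 * R" using that a(2) \<open>0 < R\<close> by linarith
      then have "x + a \<in> ball p e" "x + a \<in> ball p d" using R by (simp_all add: dist_commute)
      then show ?thesis using d(2) by blast
    qed
    have "f ((x - a) + a) = 0 \<and> w ((x - a) + a) = 0" if x: "norm (x - a) < R / 2" for x
    proof (rule dbar_unique_continuation_disc[OF c1_shift[OF f, of a] c1_shift[OF w, of a] _ _ s(1) _ _ \<open>0 < R\<close>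
          \<open>16 * R\<^sup>2 * C' \<le> 1\<close> x])
      have "{z. z + a \<in> S} = (\<lambda>z. z + a) -` S" by auto
      then show "open {z. z + a \<in> S}"
        using S(1) by (auto intro!: open_vimage continuous_intros)
      show "cball 0 R \<subseteq> {z. z + a \<in> S}" using sub by auto
    next
      fix x :: "real \<times> real" assume "x \<in> ball 0 s"
      then have "x + a \<in> ball a s" by (simp add: dist_norm)
      then have "x + a \<in> Z" using s(2) by blast
      then show "f (x + a) = 0 \<and> w (x + a) = 0" using ZS by auto
    next
      fix x :: "real \<times> real" assume "x \<in> cball 0 R"
      then have xa: "x + a \<in> ball p e" "x + a \<in> S" using sub by auto
      have "(cmod (dbar f (x + a)))\<^sup>2 + (cmod (dbar w (x + a)))\<^sup>2
          \<le> C' * ((cmod (f (x + a)))\<^sup>2 + (cmod (w (x + a)))\<^sup>2)"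
        by (rule order_trans[OF C[OF xa(1)] mult_right_mono]) (auto simp: C'_def)
      then show "(cmod (dbar (\<lambda>z. f (z + a)) x))\<^sup>2 + (cmod (dbar (\<lambda>z. w (z + a)) x))\<^sup>2
          \<le> C' * ((cmod (f (x + a)))\<^sup>2 + (cmod (w (x + a)))\<^sup>2)"
        using c1_differentiable[OF f xa(2)] c1_differentiable[OF w xa(2)]
        by (simp add: dbar_def px_shift py_shift)
    qed
    then have "f x = 0 \<and> w x = 0" if "x \<in> ball a (R / 2)" for x
      using that by (metis diff_add_cancel dist_commute dist_norm mem_ball)
    moreover have "x \<in> S" if "x \<in> ball a (R / 2)" for x
      using sub[of "x - a"] that \<open>0 < R\<close> by (simp add: dist_norm norm_minus_commute)
    ultimately have "ball a (R / 2) \<subseteq> {z \<in> S. f z = 0 \<and> w z = 0}" by blast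
    then have "ball a (R / 2) \<subseteq> Z" unfolding Z_def by (rule interior_maximal) simp
    then show "p \<in> Z" using a(2) by auto
  qed
  have "closedin (top_of_set S) Z"
  proof -
    have "Z = S \<inter> closure Z" using step ZS closure_subset by blast
    then show ?thesis by (metis closed_closure closedin_closed_Int)
  qed
  moreover have "openin (top_of_set S) Z"
    using ZS by (auto simp: Z_def intro!: open_openin_trans S(1))
  ultimately have "Z = {} \<or> Z = S"
    using S(2) by (meson connected_clopen)
  moreover have "V \<subseteq> Z" unfolding Z_def using V by (intro interior_maximal) auto
  ultimately show ?thesis using V(2) z ZS by blast
qed

section \<open>Extension by zero, power series and domains under a graph\<close>

lemma has_derivative_zero_dominated:
  assumes "(f has_derivative (\<lambda>_. 0)) (at x)" "\<And>y. norm (g y - g x) \<le> norm (f y - f x)"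
  shows "(g has_derivative (\<lambda>_. 0)) (at x)"
proof -
  have "(\<lambda>h. norm (f (x + h) - f x - 0) / norm h) \<midarrow>0\<rightarrow> 0"
    using assms(1) by (simp add: has_derivative_at)
  then have "(\<lambda>h. norm (g (x + h) - g x - 0) / norm h) \<midarrow>0\<rightarrow> 0"
  proof (rule Lim_null_comparison[rotated])
    show "\<forall>\<^sub>F h in at 0. norm (norm (g (x + h) - g x - 0) / norm h) \<le> norm (f (x + h) - f x - 0) / norm h"
      using assms(2) by (intro always_eventually allI) (auto intro!: divide_right_mono)
  qed
  then show ?thesis by (simp add: has_derivative_at)
qed

text \<open>On the line x = 0 the increments of the extension are dominated by those of f, whose
  derivative vanishes there, so differentiability needs no comparison of one-sided
  derivatives.\<close>

lemma
  fixes f :: "real \<times> real \<Rightarrow> 'a::real_normed_vector"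
  assumes f: "c1 S f" and S: "open S"
    and 0: "\<And>z. z \<in> S \<Longrightarrow> fst z = 0 \<Longrightarrow> f z = 0 \<and> px f z = 0 \<and> py f z = 0"
  defines "f\<^sub>0 \<equiv> \<lambda>z. if fst z \<le> 0 then 0 else f z"
  shows c1_extend_zero: "c1 S f\<^sub>0"
    and px_extend_zero: "z \<in> S \<Longrightarrow> px f\<^sub>0 z = (if fst z \<le> 0 then 0 else px f z)"
    and py_extend_zero: "z \<in> S \<Longrightarrow> py f\<^sub>0 z = (if fst z \<le> 0 then 0 else py f z)"
proof -
  have oL: "open {z :: real \<times> real. fst z < 0}" and oR: "open {z :: real \<times> real. fst z > 0}"
    by (auto intro!: open_Collect_less continuous_intros)
  have d: "(f\<^sub>0 has_derivative (\<lambda>k. fst k *\<^sub>R (if fst z \<le> 0 then 0 else px f z)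
      + snd k *\<^sub>R (if fst z \<le> 0 then 0 else py f z))) (at z)" if z: "z \<in> S" for z
  proof -
    consider "fst z < 0" | "fst z > 0" | "fst z = 0" by linarith
    then show ?thesis
    proof cases
      case 1
      have "((\<lambda>_. 0) has_derivative (\<lambda>_. 0)) (at z)" by simp
      then have "(f\<^sub>0 has_derivative (\<lambda>_. 0)) (at z)"
        by (rule has_derivative_transform_within_open[OF _ oL]) (use 1 in \<open>auto simp: f\<^sub>0_def\<close>)
      then show ?thesis using 1 by simp
    next
      case 2
      have "(f\<^sub>0 has_derivative (\<lambda>k. fst k *\<^sub>R px f z + snd k *\<^sub>R py f z)) (at z)"
        by (rule has_derivative_transform_within_open[OF c1D[OF f z] oR]) (use 2 in \<open>auto simp: f\<^sub>0_def\<close>)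
      then show ?thesis using 2 by simp
    next
      case 3
      have "(f has_derivative (\<lambda>_. 0)) (at z)" using c1D[OF f z] 0[OF z 3] by simp
      then have "(f\<^sub>0 has_derivative (\<lambda>_. 0)) (at z)"
        by (rule has_derivative_zero_dominated) (use 3 0[OF z 3] in \<open>auto simp: f\<^sub>0_def\<close>)
      then show ?thesis using 3 by simp
    qed
  qed
  have "continuous_on {t \<in> S. 0 \<le> fst t} (px f)" "continuous_on {t \<in> S. 0 \<le> fst t} (py f)"
    using f by (auto simp: c1_def intro: continuous_on_subset)
  then show "c1 S f\<^sub>0"
    by (intro c1I[OF d] continuous_on_cases_le continuous_intros) (use 0 in auto)
  show "z \<in> S \<Longrightarrow> px f\<^sub>0 z = (if fst z \<le> 0 then 0 else px f z)"
    "z \<in> S \<Longrightarrow> py f\<^sub>0 z = (if fst z \<le> 0 then 0 else py f z)"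
    using d[of z] by (simp_all add: has_derivative_px has_derivative_py)
qed

section \<open>Analytic functions as locally Lipschitz coefficients\<close>

lemma power_series_derivative_lipschitz:
  fixes f :: "real \<Rightarrow> real"
  assumes r: "0 < r" and f: "\<And>y. \<bar>y - x\<bar> < r \<Longrightarrow> (\<lambda>n. a n * (y - x) ^ n) sums f y"
  obtains f' K where "\<And>y. \<bar>y - x\<bar> < r \<Longrightarrow> (f has_real_derivative f' y) (at y)"
    "\<And>y z. \<bar>y - x\<bar> \<le> r / 2 \<Longrightarrow> \<bar>z - x\<bar> \<le> r / 2 \<Longrightarrow> \<bar>f y - f z\<bar> \<le> K * \<bar>y - z\<bar>"
    "\<And>y z. \<bar>y - x\<bar> \<le> r / 2 \<Longrightarrow> \<bar>z - x\<bar> \<le> r / 2 \<Longrightarrow> \<bar>f' y - f' z\<bar> \<le> K * \<bar>y - z\<bar>"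
proof -
  define S where "S c y = (\<Sum>n. c n * (y - x) ^ n)" for c :: "nat \<Rightarrow> real" and y
  define conv where "conv c \<longleftrightarrow> (\<forall>t. norm t < r \<longrightarrow> summable (\<lambda>n. c n * t ^ n))" for c :: "nat \<Rightarrow> real"
  have sa: "conv a"
    unfolding conv_def
  proof (intro allI impI)
    fix t :: real assume "norm t < r"
    then show "summable (\<lambda>n. a n * t ^ n)" using f[of "x + t"] by (simp add: sums_iff)
  qed
  have sd: "conv (diffs c)" if "conv c" for c
    using that termdiff_converges[of _ r c] by (auto simp: conv_def)
  have deriv: "(S c has_real_derivative S (diffs c) y) (at y)"
    if c: "conv c" and y: "\<bar>y - x\<bar> < r" for c y
  proof -
    obtain k where k: "\<bar>y - x\<bar> < k" "k < r" using y dense by blast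
    have "((\<lambda>t. \<Sum>n. c n * t ^ n) has_real_derivative (\<Sum>n. diffs c n * (y - x) ^ n)) (at (y - x))"
      by (rule termdiffs_strong[of c k]) (use k c in \<open>auto simp: conv_def\<close>)
    then show ?thesis unfolding S_def[abs_def]
      using DERIV_shift[of "\<lambda>t. \<Sum>n. c n * t ^ n" _ y "- x"] by simp
  qed
  let ?I = "cball x (r / 2)"
  \<comment> \<open>Stated for any coefficient sequence, so that it applies both to the series and
    to its formal derivative \<open>diffs a\<close>. Half the radius gives a compact interval, on
    which the derivative is bounded.\<close>
  have lip: "\<exists>K. \<forall>y\<in>?I. \<forall>z\<in>?I. \<bar>S c y - S c z\<bar> \<le> K * \<bar>y - z\<bar>"
    if c: "conv c" for c
  proof -
    have sub: "\<bar>y - x\<bar> < r" if "y \<in> ?I" for y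
      using that r by (auto simp: dist_real_def abs_minus_commute)
    have "continuous_on ?I (S (diffs c))"
      by (intro continuous_at_imp_continuous_on ballI DERIV_isCont[OF deriv[OF sd[OF c]]] sub)
    then have "bounded (S (diffs c) ` ?I)"
      by (intro compact_imp_bounded compact_continuous_image) auto
    then obtain K where K: "\<And>y. y \<in> ?I \<Longrightarrow> norm (S (diffs c) y) \<le> K"
      unfolding bounded_iff by blast
    have "norm (S c y - S c z) \<le> K * norm (y - z)" if "y \<in> ?I" "z \<in> ?I" for y z
      by (rule field_differentiable_bound[OF convex_cball _ K that])
        (auto intro!: has_field_derivative_at_within[OF deriv[OF c]] sub)
    then show ?thesis unfolding real_norm_def by blast
  qed
  obtain K1 where K1: "\<And>y z. y \<in> ?I \<Longrightarrow> z \<in> ?I \<Longrightarrow> \<bar>S a y - S a z\<bar> \<le> K1 * \<bar>y - z\<bar>"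
    using lip[OF sa] by blast
  obtain K2 where K2: "\<And>y z. y \<in> ?I \<Longrightarrow> z \<in> ?I \<Longrightarrow> \<bar>S (diffs a) y - S (diffs a) z\<bar> \<le> K2 * \<bar>y - z\<bar>"
    using lip[OF sd[OF sa]] by blast
  have fS: "S a y = f y" if "\<bar>y - x\<bar> < r" for y
    using f[OF that] by (simp add: S_def sums_iff)
  show thesis
  proof (rule that)
    show "(f has_real_derivative S (diffs a) y) (at y)" if y: "\<bar>y - x\<bar> < r" for y
    proof (rule has_field_derivative_transform_within_open[OF deriv[OF sa y], of "ball x r"])
      show "S a z = f z" if "z \<in> ball x r" for z
        using that by (intro fS) (simp add: dist_real_def abs_minus_commute)
    qed (use y in \<open>auto simp: dist_real_def abs_minus_commute\<close>)
  next
    fix y z assume *: "\<bar>y - x\<bar> \<le> r / 2" "\<bar>z - x\<bar> \<le> r / 2"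
    then have yz: "y \<in> ?I" "z \<in> ?I" by (auto simp: dist_real_def abs_minus_commute)
    have "K1 * \<bar>y - z\<bar> \<le> max K1 K2 * \<bar>y - z\<bar>" "K2 * \<bar>y - z\<bar> \<le> max K1 K2 * \<bar>y - z\<bar>"
      by (auto intro!: mult_right_mono)
    then show "\<bar>f y - f z\<bar> \<le> max K1 K2 * \<bar>y - z\<bar>"
      "\<bar>S (diffs a) y - S (diffs a) z\<bar> \<le> max K1 K2 * \<bar>y - z\<bar>"
      using K1[OF yz] K2[OF yz] fS[of y] fS[of z] * r by auto
  qed
qed

text \<open>One statement serves both data functions: the Lipschitz bound on f is applied to
  \<open>\<beta>\<close>, the one on its derivative to the streamline density.\<close>

lemma real_analytic_on_interior:
  assumes f: "real_analytic_on f {a..b}" and x: "a < x" "x < b"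
  obtains f' K e where "0 < e" "{x - e..x + e} \<subseteq> {a<..<b}"
    "\<And>y. y \<in> {x - e..x + e} \<Longrightarrow> (f has_real_derivative f' y) (at y)"
    "\<And>y z. y \<in> {x - e..x + e} \<Longrightarrow> z \<in> {x - e..x + e} \<Longrightarrow> \<bar>f y - f z\<bar> \<le> K * \<bar>y - z\<bar>"
    "\<And>y z. y \<in> {x - e..x + e} \<Longrightarrow> z \<in> {x - e..x + e} \<Longrightarrow> \<bar>f' y - f' z\<bar> \<le> K * \<bar>y - z\<bar>"
proof -
  obtain r c where r: "r > 0" and s: "\<And>y. y \<in> {a..b} \<Longrightarrow> \<bar>y - x\<bar> < r \<Longrightarrow> (\<lambda>n. c n * (y - x) ^ n) sums f y"
    using f x unfolding real_analytic_on_def by (metis atLeastAtMost_iff less_imp_le)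
  define q where "q = min r (min (x - a) (b - x))"
  have q: "0 < q" "q \<le> r" "q \<le> x - a" "q \<le> b - x" using r x by (auto simp: q_def)
  obtain f' K where *: "\<And>y. \<bar>y - x\<bar> < q \<Longrightarrow> (f has_real_derivative f' y) (at y)"
    "\<And>y z. \<bar>y - x\<bar> \<le> q / 2 \<Longrightarrow> \<bar>z - x\<bar> \<le> q / 2 \<Longrightarrow> \<bar>f y - f z\<bar> \<le> K * \<bar>y - z\<bar>"
    "\<And>y z. \<bar>y - x\<bar> \<le> q / 2 \<Longrightarrow> \<bar>z - x\<bar> \<le> q / 2 \<Longrightarrow> \<bar>f' y - f' z\<bar> \<le> K * \<bar>y - z\<bar>"
    by (rule power_series_derivative_lipschitz[OF q(1), of x c f]) (use q in \<open>auto intro!: s simp: abs_less_iff\<close>)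
  have I: "\<bar>y - x\<bar> \<le> q / 2" "\<bar>y - x\<bar> < q" if "y \<in> {x - q / 2..x + q / 2}" for y
    using that q(1) unfolding atLeastAtMost_iff abs_le_iff abs_less_iff by linarith+
  show thesis
  proof (rule that[of "q / 2" f' K])
    show "{x - q / 2..x + q / 2} \<subseteq> {a<..<b}" using q by auto
    show "0 < q / 2" using q(1) by simp
  qed (intro * I; assumption)+
qed

text \<open>At an end point S lies on one side only, but convergence at a single nearby point of S
  already gives convergence on a two-sided neighbourhood, where the power series is continuous. An
  isolated point is trivial.\<close>

lemma real_analytic_on_continuous:
  assumes "real_analytic_on f S"
  shows "continuous_on S f"
  unfolding continuous_on_eq_continuous_within
proof
  fix x assume x: "x \<in> S"
  obtain r c where r: "r > 0" and s: "\<And>y. y \<in> S \<Longrightarrow> \<bar>y - x\<bar> < r \<Longrightarrow> (\<lambda>n. c n * (y - x) ^ n) sums f y"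
    using assms x unfolding real_analytic_on_def by metis
  show "continuous (at x within S) f"
  proof (cases "x islimpt S")
    case False
    then show ?thesis by (simp add: continuous_within trivial_limit_within Lim_trivial_limit)
  next
    case True
    then obtain y where y: "y \<in> S" "y \<noteq> x" "dist y x < r" using r by (auto simp: islimpt_approachable)
    define k where "k = \<bar>y - x\<bar>"
    have k: "0 < k" "k < r" using y by (auto simp: k_def dist_real_def)
    define F where "F t = (\<Sum>n. c n * (t - x) ^ n)" for t
    have "summable (\<lambda>n. c n * (y - x) ^ n)" using s[OF y(1)] k by (simp add: k_def sums_iff)
    then have "isCont (\<lambda>t. \<Sum>n. c n * t ^ n) (x - x)"
      by (rule isCont_powser) (use k in \<open>auto simp: k_def\<close>)
    then have "isCont F x"
      unfolding F_def[abs_def]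
      by (rule isCont_o2[where f = "\<lambda>t. t - x", rotated]) (auto intro!: continuous_intros)
    then have "continuous (at x within S) F" by (rule continuous_at_imp_continuous_within)
    moreover have "F t = f t" if "t \<in> S" "dist t x < r" for t
      using s[of t] that by (simp add: F_def dist_real_def sums_iff)
    ultimately show ?thesis
      using continuous_transform_within[of x S F r f] r x by (simp add: dist_commute)
  qed
qed

text \<open>Stretching each vertical segment affinely maps a rectangle continuously onto the
  region.\<close>

lemma connected_under_graph:
  fixes m :: "real \<Rightarrow> real"
  assumes m: "continuous_on {a<..<b} m" and d: "\<And>x. x \<in> {a<..<b} \<Longrightarrow> d < m x"
  shows "connected {z. fst z \<in> {a<..<b} \<and> d < snd z \<and> snd z < m (fst z)}"
proof -
  let ?M = "\<lambda>z. (fst z, d + snd z * (m (fst z) - d))"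
  let ?R = "{a<..<b} \<times> {0<..<1::real}"
  have "continuous_on ?R ?M"
    by (intro continuous_intros continuous_on_compose2[OF m]) auto
  moreover have "connected ?R" by (intro connected_Times connected_Ioo)
  ultimately have "connected (?M ` ?R)" by (rule connected_continuous_image)
  also have "?M ` ?R = {z. fst z \<in> {a<..<b} \<and> d < snd z \<and> snd z < m (fst z)}"
  proof (intro equalityI subsetI)
    fix z assume "z \<in> ?M ` ?R"
    then obtain x s where z: "z = (x, d + s * (m x - d))" and x: "x \<in> {a<..<b}" "0 < s" "s < 1" by force
    have "0 < s * (m x - d)" "s * (m x - d) < 1 * (m x - d)"
      using x d[OF x(1)] by (auto intro!: mult_strict_right_mono)
    then show "z \<in> {z. fst z \<in> {a<..<b} \<and> d < snd z \<and> snd z < m (fst z)}" using x z by simp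
  next
    fix z assume z: "z \<in> {z. fst z \<in> {a<..<b} \<and> d < snd z \<and> snd z < m (fst z)}"
    then have "0 < m (fst z) - d" by auto
    then have "z = ?M (fst z, (snd z - d) / (m (fst z) - d))"
      "(fst z, (snd z - d) / (m (fst z) - d)) \<in> ?R"
      using z by (auto simp: prod_eq_iff)
    then show "z \<in> ?M ` ?R" by blast
  qed
  finally show ?thesis .
qed

lemma c1_inverse:
  fixes f :: "real \<times> real \<Rightarrow> real"
  assumes f: "c1 S f" and 0: "\<And>z. z \<in> S \<Longrightarrow> f z \<noteq> 0"
  shows "c1 S (\<lambda>z. inverse (f z))"
proof (rule c1I)
  fix z assume z: "z \<in> S"
  from Deriv.has_derivative_inverse[OF 0[OF z] c1D[OF f z]]
  show "((\<lambda>z. inverse (f z)) has_derivative (\<lambda>k. fst k *\<^sub>R (- (inverse (f z) * px f z * inverse (f z)))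
      + snd k *\<^sub>R (- (inverse (f z) * py f z * inverse (f z))))) (at z)"
    by (simp add: algebra_simps)
qed (use f c1_continuous_on[OF f] 0 in \<open>auto simp: c1_def intro!: continuous_intros\<close>)

lemma holder_on_continuous:
  assumes "0 < \<alpha>" "holder_on \<alpha> S f"
  shows "continuous_on S f"
proof -
  obtain K where K: "\<And>z z'. z \<in> S \<Longrightarrow> z' \<in> S \<Longrightarrow> \<bar>f z - f z'\<bar> \<le> K * dist z z' powr \<alpha>"
    using assms(2) unfolding holder_on_def by blast
  show ?thesis
    unfolding continuous_on_def
  proof
    fix x assume x: "x \<in> S"
    have "((\<lambda>z. dist z x powr \<alpha>) \<longlongrightarrow> 0 powr \<alpha>) (at x within S)"
      using assms(1) by (intro tendsto_powr' tendsto_eq_intros) (auto simp: eventually_at_filter intro!: tendsto_eq_intros)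
    then have "((\<lambda>z. K * dist z x powr \<alpha>) \<longlongrightarrow> 0) (at x within S)"
      using assms(1) by (auto intro!: tendsto_eq_intros)
    then have "((\<lambda>z. f z - f x) \<longlongrightarrow> 0) (at x within S)"
      by (rule Lim_null_comparison[rotated]) (use K x in \<open>auto simp: eventually_at_filter\<close>)
    then show "(f \<longlongrightarrow> f x) (at x within S)" by (simp add: LIM_zero_cancel)
  qed
qed

section \<open>The equations satisfied by one wave\<close>

locale symmetric_wave =
  fixes g d c Patm :: real and W :: wave and \<psi> :: "real \<times> real \<Rightarrow> real" and p0 :: real
    and r \<beta> :: "real \<Rightarrow> real"
  assumes wave: "symmetric_stratified_wave g d c Patm W \<psi> p0 r \<beta>"
begin

abbreviation "\<eta> \<equiv> profile W"
abbreviation "u \<equiv> hvel W"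
abbreviation "v \<equiv> vvel W"
abbreviation "P \<equiv> pressure W"
abbreviation "\<rho> \<equiv> density W"
abbreviation "D \<equiv> fluid d W"

text \<open>\<open>A\<close> is psi_y, and \<open>B\<close> below is - psi_x.\<close>

definition A where "A z = sqrt (\<rho> z) * (u z - c)"
definition B where "B z = sqrt (\<rho> z) * v z"

definition inner where "inner = {z. - d < snd z \<and> snd z < \<eta> (fst z)}"
text \<open>The height function is assumed regular only for q in [-pi, pi]; over the open period the
  map (x, y) -> (x, - psi) lands in the interior of its domain, where full derivatives
  exist.\<close>

definition cell where "cell = {z \<in> inner. fst z \<in> {- pi<..<pi}}"

lemma steady: "steady_wave g d c Patm W"
  and stream: "pseudo_stream_function d c W \<psi>"
  and flux: "pseudo_mass_flux d c W p0"
  and classical: "classical_wave d W \<psi> p0"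
  and symmetric: "symmetric_about_crest d W \<psi>"
  and strdens: "streamline_density d W \<psi> p0 r"
  and bernoulli: "bernoulli_function g d c W \<psi> p0 \<beta>"
  using wave by (simp_all add: symmetric_stratified_wave_def)

lemma mem_fluid: "(x, y) \<in> D \<longleftrightarrow> - d \<le> y \<and> y \<le> \<eta> x"
  by (simp add: fluid_def)

lemma eta_gt: "- d < \<eta> x"
  using steady by (simp add: steady_wave_def)

lemma continuous_on_eta: "continuous_on S \<eta>"
proof -
  have "boundary_conditions d c Patm W" using steady by (simp add: steady_wave_def)
  then have "\<eta> differentiable (at x)" for x
    unfolding boundary_conditions_def by (metis real_differentiable_def)
  then show ?thesis
    by (intro continuous_at_imp_continuous_on ballI differentiable_imp_continuous_within)
qed

lemma open_inner: "open inner"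
  unfolding inner_def Collect_conj_eq
  by (intro open_Int open_Collect_less continuous_intros continuous_on_compose2[OF continuous_on_eta]) auto

lemma open_cell: "open cell"
proof -
  have "cell = inner \<inter> fst -` {- pi<..<pi}" by (auto simp: cell_def)
  then show ?thesis by (auto intro!: open_Int open_inner open_vimage_fst)
qed

lemma inner_subset: "inner \<subseteq> D" and cell_subset: "cell \<subseteq> inner"
  by (auto simp: inner_def cell_def fluid_def)

lemma at_inner: "z \<in> inner \<Longrightarrow> at z within D = at z"
  by (rule at_within_open_subset[OF _ open_inner inner_subset])

lemma density_pos: "z \<in> D \<Longrightarrow> 0 < \<rho> z" and hvel_less: "z \<in> D \<Longrightarrow> u z < c"
  using steady by (simp_all add: steady_wave_def)

lemma A_neg: "z \<in> D \<Longrightarrow> A z < 0"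
  using density_pos[of z] hvel_less[of z] by (simp add: A_def mult_pos_neg)

section \<open>Values, monotonicity and symmetry of the stream function\<close>

lemma psi_surface: "\<psi> (x, \<eta> x) = 0"
  using stream by (simp add: pseudo_stream_function_def)

lemma psi_derivative: "z \<in> D \<Longrightarrow> (\<psi> has_derivative (\<lambda>k. - B z * fst k + A z * snd k)) (at z within D)"
  using stream by (simp add: pseudo_stream_function_def has_gradient_on_def A_def B_def)

lemma continuous_on_psi: "continuous_on D \<psi>"
  using psi_derivative has_derivative_continuous continuous_on_eq_continuous_within by blast

lemma psi_vertical:
  assumes "y \<in> {- d..\<eta> x}"
  shows "((\<lambda>t. \<psi> (x, t)) has_real_derivative A (x, y)) (at y within {- d..\<eta> x})"
proof -
  have 1: "((\<lambda>t::real. (x, t)) has_derivative (\<lambda>t. (0, t))) (at y within {- d..\<eta> x})"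
    by (auto intro!: derivative_eq_intros)
  have "(\<psi> has_derivative (\<lambda>k. - B (x, y) * fst k + A (x, y) * snd k)) (at (x, y) within (\<lambda>t. (x, t)) ` {- d..\<eta> x})"
    by (rule has_derivative_subset[OF psi_derivative]) (use assms in \<open>auto simp: mem_fluid\<close>)
  from diff_chain_within[OF 1 this] show ?thesis
    by (simp add: has_field_derivative_def o_def)
qed

lemma psi_decreasing:
  assumes "- d \<le> s" "s < t" "t \<le> \<eta> x"
  shows "\<psi> (x, t) < \<psi> (x, s)"
proof (rule DERIV_neg_imp_decreasing_open[OF assms(2), of "\<lambda>t. \<psi> (x, t)"])
  fix y assume "s < y" "y < t"
  then have y: "y \<in> {- d<..<\<eta> x}" using assms by auto
  then have "at y within {- d..\<eta> x} = at y" by (intro at_within_interior) auto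
  then show "\<exists>k. ((\<lambda>t. \<psi> (x, t)) has_real_derivative k) (at y) \<and> k < 0"
    using psi_vertical[of y x] A_neg[of "(x, y)"] y by (auto simp: mem_fluid)
next
  show "continuous_on {s..t} (\<lambda>t. \<psi> (x, t))"
    by (intro continuous_on_compose2[OF continuous_on_psi] continuous_intros) (use assms in \<open>auto simp: mem_fluid\<close>)
qed

text \<open>The mass flux is the integral of psi_y over a column, hence the difference of the values
  at its two ends.\<close>

lemma psi_bed: "\<psi> (x, - d) = - p0"
proof -
  have "((\<lambda>y. A (x, y)) has_integral (\<psi> (x, \<eta> x) - \<psi> (x, - d))) {- d..\<eta> x}"
    by (rule fundamental_theorem_of_calculus)
      (use psi_vertical eta_gt[of x] in \<open>auto simp flip: has_real_derivative_iff_has_vector_derivative\<close>)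
  moreover have "((\<lambda>y. A (x, y)) has_integral p0) {- d..\<eta> x}"
    using flux by (simp add: pseudo_mass_flux_def A_def)
  ultimately have "\<psi> (x, \<eta> x) - \<psi> (x, - d) = p0" by (rule has_integral_unique)
  then show ?thesis by (simp add: psi_surface)
qed

lemma psi_inner: "z \<in> inner \<Longrightarrow> \<psi> z \<in> {0<..<- p0}"
  using psi_decreasing[of "snd z" "\<eta> (fst z)" "fst z"] psi_decreasing[of "- d" "snd z" "fst z"]
  by (auto simp: inner_def psi_surface psi_bed)

lemma psi_range:
  assumes "z \<in> D"
  shows "\<psi> z \<in> {0..- p0}"
proof -
  obtain x y where z: "z = (x, y)" by (cases z)
  show ?thesis
    using psi_decreasing[of y "\<eta> x" x] psi_decreasing[of "- d" y x] assms eta_gt[of x]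
      psi_decreasing[of "- d" "\<eta> x" x]
    by (cases "y = \<eta> x"; cases "y = - d") (auto simp: z mem_fluid psi_surface psi_bed)
qed

lemma density_eq: "z \<in> D \<Longrightarrow> \<rho> z = r (- \<psi> z)"
  using strdens by (simp add: streamline_density_def)

lemma reflection:
  assumes "(x, y) \<in> D"
  shows "(- x, y) \<in> D" "\<psi> (- x, y) = \<psi> (x, y)"
proof -
  have "(x, y) \<in> streamline d W \<psi> (\<psi> (x, y))" using assms by (simp add: streamline_def)
  then have "(\<lambda>(x, y). (- x, y)) (x, y) \<in> (\<lambda>(x, y). (- x, y)) ` streamline d W \<psi> (\<psi> (x, y))"
    by (rule imageI)
  then have "(- x, y) \<in> streamline d W \<psi> (\<psi> (x, y))"
    using symmetric by (simp add: symmetric_about_crest_def)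
  then show "(- x, y) \<in> D" "\<psi> (- x, y) = \<psi> (x, y)" by (auto simp: streamline_def)
qed

lemma psi_derivative_inner:
  "z \<in> inner \<Longrightarrow> (\<psi> has_derivative (\<lambda>k. fst k *\<^sub>R (- B z) + snd k *\<^sub>R A z)) (at z)"
  using psi_derivative[of z] at_inner[of z] inner_subset by (auto simp: algebra_simps)

lemma px_psi: "z \<in> inner \<Longrightarrow> px \<psi> z = - B z" and py_psi: "z \<in> inner \<Longrightarrow> py \<psi> z = A z"
  by (simp_all add: has_derivative_px[OF psi_derivative_inner] has_derivative_py[OF psi_derivative_inner])

text \<open>Near the axis psi is even in x, and the derivative of an even function vanishes at
  0.\<close>

lemma B_axis:
  assumes "(0, y) \<in> inner"
  shows "B (0, y) = 0"
proof -
  let ?k = "\<lambda>t. \<psi> (t, y)"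
  have k: "(?k has_real_derivative - B (0, y)) (at 0)"
    using has_vector_derivative_px[of \<psi> 0 y UNIV] psi_derivative_inner[OF assms] px_psi[OF assms]
    by (auto simp: differentiable_def has_real_derivative_iff_has_vector_derivative)
  have "((\<lambda>t. ?k (- t)) has_real_derivative - B (0, y) * (- 1)) (at 0)"
    by (rule DERIV_chain2[of ?k]) (use k in \<open>auto intro!: derivative_eq_intros\<close>)
  moreover have "open ((\<lambda>t. (t, y)) -` inner)"
    by (intro open_vimage open_inner continuous_intros)
  then have "((\<lambda>t. ?k (- t)) has_real_derivative - B (0, y)) (at 0)"
    by (rule has_field_derivative_transform_within_open[OF k])
      (use assms inner_subset in \<open>auto simp: reflection(2)\<close>)
  ultimately have "- B (0, y) * (- 1) = - B (0, y)" by (rule DERIV_unique)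
  then show ?thesis by simp
qed

text \<open>Differentiating h(x, - psi) = y + d gives h_p A = - 1 and h_q + h_p B = 0. Thus A and B
  are rational expressions in h_q and h_p, which are C^1 by hypothesis, composed with (x, -
  psi).\<close>

lemma c1_AB: "c1 cell A" "c1 cell B"
proof -
  obtain h \<alpha> where \<alpha>: "0 < \<alpha>" and h: "height_function d W \<psi> h"
    and C2: "C2_holder_on \<alpha> ({- pi..pi} \<times> {p0..0}) h"
    using classical unfolding classical_wave_def by blast
  let ?S = "{- pi..pi} \<times> {p0..0}"
  obtain hq hp hqq hqp hpp where gh: "has_gradient_on h hq hp ?S" "has_gradient_on hq hqq hqp ?S"
    "has_gradient_on hp hqp hpp ?S" and ho: "holder_on \<alpha> ?S hqq" "holder_on \<alpha> ?S hqp" "holder_on \<alpha> ?S hpp"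
    using C2 unfolding C2_holder_on_def by blast
  define \<Phi> where "\<Phi> z = (fst z, - \<psi> z)" for z
  define T where "T = {- pi<..<pi} \<times> {p0<..<0}"
  have T: "open T" "T \<subseteq> ?S" by (auto simp: T_def intro!: open_Times)
  have \<Phi>T: "\<Phi> z \<in> T" if "z \<in> cell" for z
    using that psi_inner[of z] cell_subset by (auto simp: cell_def \<Phi>_def T_def)
  have d\<Phi>: "(\<Phi> has_derivative (\<lambda>k. (fst k, B z * fst k - A z * snd k))) (at z)" if "z \<in> cell" for z
  proof -
    have "z \<in> inner" using that cell_subset by blast
    from has_derivative_Pair[OF has_derivative_fst[OF has_derivative_ident] has_derivative_minus[OF psi_derivative_inner[OF this]]]
    show ?thesis by (simp add: \<Phi>_def[abs_def] algebra_simps)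
  qed
  have c\<Phi>: "continuous_on cell \<Phi>"
    using d\<Phi> by (auto intro!: continuous_at_imp_continuous_on has_derivative_continuous)
  have comp: "((\<lambda>z. f (\<Phi> z)) has_derivative (\<lambda>k. fst k *\<^sub>R (fx (\<Phi> z) + fy (\<Phi> z) * B z)
      + snd k *\<^sub>R (- (fy (\<Phi> z) * A z)))) (at z)"
    if f: "has_gradient_on f fx fy ?S" and z: "z \<in> cell" for f fx fy z
  proof -
    have "(f has_derivative (\<lambda>k. fx (\<Phi> z) * fst k + fy (\<Phi> z) * snd k)) (at (\<Phi> z))"
      using f \<Phi>T[OF z] T at_within_open_subset[OF \<Phi>T[OF z] T] unfolding has_gradient_on_def by (metis subsetD)
    from has_derivative_compose[OF d\<Phi>[OF z] this] show ?thesis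
      by (simp add: algebra_simps)
  qed
  have AB: "hp (\<Phi> z) * A z = - 1" "hq (\<Phi> z) + hp (\<Phi> z) * B z = 0" if z: "z \<in> cell" for z
  proof -
    have "((\<lambda>z. snd z + d) has_derivative snd) (at z)"
      by (auto intro!: derivative_eq_intros)
    then have 1: "((\<lambda>z. h (\<Phi> z)) has_derivative snd) (at z)"
    proof (rule has_derivative_transform_within_open[OF _ open_cell z])
      fix z assume "z \<in> cell"
      then have "z \<in> D" using cell_subset inner_subset by blast
      then show "snd z + d = h (\<Phi> z)"
        using h by (cases z) (auto simp: height_function_def \<Phi>_def)
    qed
    have "px (\<lambda>z. h (\<Phi> z)) z = 0" "py (\<lambda>z. h (\<Phi> z)) z = 1"
      using has_derivative_px[OF 1] has_derivative_py[OF 1] by auto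
    then show "hp (\<Phi> z) * A z = - 1" "hq (\<Phi> z) + hp (\<Phi> z) * B z = 0"
      using has_derivative_px[OF comp[OF gh(1) z]] has_derivative_py[OF comp[OF gh(1) z]] by auto
  qed
  have hp0: "hp (\<Phi> z) \<noteq> 0" if "z \<in> cell" for z using AB(1)[OF that] by auto
  have Aeq: "A z = - inverse (hp (\<Phi> z))" and Beq: "B z = hq (\<Phi> z) * (- inverse (hp (\<Phi> z)))" if "z \<in> cell" for z
    using AB[OF that] hp0[OF that] by (auto simp: field_simps)
  have cS: "continuous_on cell (\<lambda>z. f (\<Phi> z))" if "continuous_on ?S f" for f
    by (rule continuous_on_compose2[OF that c\<Phi>]) (use \<Phi>T T in blast)
  have cg: "continuous_on ?S f" if "has_gradient_on f fx fy ?S" for f fx fy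
    using that unfolding has_gradient_on_def continuous_on_eq_continuous_within
    by (blast intro: has_derivative_continuous)
  note ch = holder_on_continuous[OF \<alpha> ho(1), THEN cS] holder_on_continuous[OF \<alpha> ho(2), THEN cS]
    holder_on_continuous[OF \<alpha> ho(3), THEN cS] cg[OF gh(2), THEN cS] cg[OF gh(3), THEN cS]
  \<comment> \<open>A bootstrap: the derivatives of h_q and h_p along \<open>\<Phi>\<close> contain
    A and B, so continuity of A and B must precede their C^1 regularity.\<close>
  have cA': "continuous_on cell (\<lambda>z. - inverse (hp (\<Phi> z)))"
    by (intro continuous_intros ch) (use hp0 in auto)
  then have cA: "continuous_on cell A" using Aeq by (simp cong: continuous_on_cong)
  have "continuous_on cell (\<lambda>z. hq (\<Phi> z) * (- inverse (hp (\<Phi> z))))"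
    by (intro continuous_on_mult cA' ch)
  then have cB: "continuous_on cell B" using Beq by (simp cong: continuous_on_cong)
  have c1hp: "c1 cell (\<lambda>z. hp (\<Phi> z))" and c1hq: "c1 cell (\<lambda>z. hq (\<Phi> z))"
    by (intro c1I[OF comp[OF gh(3)]] c1I[OF comp[OF gh(2)]] continuous_intros ch cA cB; assumption)+
  have "c1 cell (\<lambda>z. 0 - inverse (hp (\<Phi> z)))"
    by (intro c1_diff c1_const c1_inverse c1hp hp0)
  then have 1: "c1 cell (\<lambda>z. - inverse (hp (\<Phi> z)))" by simp
  then show "c1 cell A"
    using c1_cong[OF open_cell, of A "\<lambda>z. - inverse (hp (\<Phi> z))"] Aeq by blast
  show "c1 cell B"
    using c1_cong[OF open_cell, of B "\<lambda>z. hq (\<Phi> z) * (- inverse (hp (\<Phi> z)))"] Beq c1_mult[OF c1hq 1] by blast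
qed

lemma continuous_on_velocity: "continuous_on D u" "continuous_on D v"
proof -
  have *: "continuous_on D f" if "has_gradient_on f fx fy D" for f fx fy
    using that unfolding has_gradient_on_def continuous_on_eq_continuous_within
    by (blast intro: has_derivative_continuous)
  have "euler_equations g d c W" using steady by (simp add: steady_wave_def)
  then obtain ux uy vx vy where "has_gradient_on u ux uy D" "has_gradient_on v vx vy D"
    unfolding euler_equations_def Let_def by (elim exE conjE) (rule that)
  then show "continuous_on D u" "continuous_on D v" using * by blast+
qed

text \<open>The first identity is the symmetry of the mixed derivatives of psi; it follows from
  incompressibility and the transport of density. The second is the elliptic equation for psi:
  Bernoulli's law differentiated in y, with P_y eliminated by the vertical momentum equation. Only
  first derivatives of the physical fields occur.\<close>

lemma field_equations:
  assumes z: "z \<in> inner" and r': "(r has_real_derivative r') (at (- \<psi> z))"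
  shows "px A z + py B z = 0" "py A z - px B z = g * snd z * r' - \<beta> (\<psi> z)"
proof -
  have zD: "z \<in> D" using z inner_subset by blast
  have "euler_equations g d c W" using steady by (simp add: steady_wave_def)
  then obtain ux uy vx vy Px Py \<rho>x \<rho>y where
    grad: "has_gradient_on u ux uy D" "has_gradient_on v vx vy D" "has_gradient_on P Px Py D"
      "has_gradient_on \<rho> \<rho>x \<rho>y D" and
    eqs: "\<forall>z\<in>D. ux z + vy z = 0 \<and> (u z - c) * \<rho>x z + v z * \<rho>y z = 0 \<and>
           \<rho> z * (u z - c) * ux z + \<rho> z * v z * uy z = - Px z \<and>
           \<rho> z * (u z - c) * vx z + \<rho> z * v z * vy z = - Py z - g * \<rho> z"
    unfolding euler_equations_def Let_def by (elim exE conjE) (rule that)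
  have g: "(f has_derivative (\<lambda>k. fx z * fst k + fy z * snd k)) (at z)" if "has_gradient_on f fx fy D" for f fx fy
    using that zD at_inner[OF z] unfolding has_gradient_on_def by metis
  note du = g[OF grad(1)] note dv = g[OF grad(2)] note dP = g[OF grad(3)] note d\<rho> = g[OF grad(4)]
  have \<rho>0: "0 < \<rho> z" by (rule density_pos[OF zD])
  define s where "s = sqrt (\<rho> z)"
  have s: "0 < s" "s * s = \<rho> z" using \<rho>0 by (simp_all add: s_def)
  have dA: "(A has_derivative (\<lambda>k. s * (ux z * fst k + uy z * snd k)
      + (\<rho>x z * fst k + \<rho>y z * snd k) * inverse s / 2 * (u z - c))) (at z)"
    unfolding A_def[abs_def] s_def
    by (rule derivative_eq_intros du d\<rho> \<rho>0 refl)+ (simp add: fun_eq_iff)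
  have dB: "(B has_derivative (\<lambda>k. s * (vx z * fst k + vy z * snd k)
      + (\<rho>x z * fst k + \<rho>y z * snd k) * inverse s / 2 * v z)) (at z)"
    unfolding B_def[abs_def] s_def
    by (rule derivative_eq_intros dv d\<rho> \<rho>0 refl)+ (simp add: fun_eq_iff)
  \<comment> \<open>Multiplying by 2 sqrt(rho) clears the square roots and makes the remaining
    computation polynomial.\<close>
  have A': "2 * s * px A z = 2 * \<rho> z * ux z + \<rho>x z * (u z - c)" "2 * s * py A z = 2 * \<rho> z * uy z + \<rho>y z * (u z - c)"
    and B': "2 * s * px B z = 2 * \<rho> z * vx z + \<rho>x z * v z" "2 * s * py B z = 2 * \<rho> z * vy z + \<rho>y z * v z"
    using has_derivative_px[OF dA] has_derivative_py[OF dA] has_derivative_px[OF dB] has_derivative_py[OF dB] s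
    by (simp_all add: field_simps)
  have eq: "ux z + vy z = 0" "(u z - c) * \<rho>x z + v z * \<rho>y z = 0"
    "\<rho> z * (u z - c) * vx z + \<rho> z * v z * vy z = - Py z - g * \<rho> z"
    using eqs zD by blast+
  have "2 * s * (px A z + py B z) = 2 * \<rho> z * (ux z + vy z) + ((u z - c) * \<rho>x z + v z * \<rho>y z)"
    unfolding distrib_left A' B' by (simp add: algebra_simps)
  then show "px A z + py B z = 0" using eq s(1) by simp
  obtain E where E: "\<And>z. z \<in> D \<Longrightarrow> energy g c W z = E (\<psi> z)"
    "\<And>s. s \<in> {0..\<bar>p0\<bar>} \<Longrightarrow> (E has_real_derivative - \<beta> s) (at s within {0..\<bar>p0\<bar>})"
    using bernoulli unfolding bernoulli_function_def by blast
  have "\<psi> z \<in> {0<..<\<bar>p0\<bar>}" using psi_inner[OF z] by auto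
  moreover from this have "at (\<psi> z) within {0..\<bar>p0\<bar>} = at (\<psi> z)"
    by (intro at_within_interior) simp
  ultimately have dE: "(E has_real_derivative - \<beta> (\<psi> z)) (at (\<psi> z))"
    using E(2)[of "\<psi> z"] by auto
  have "((\<lambda>z. E (\<psi> z)) has_derivative (\<lambda>k. - \<beta> (\<psi> z) * (fst k *\<^sub>R (- B z) + snd k *\<^sub>R A z))) (at z)"
    by (rule has_derivative_compose[OF psi_derivative_inner[OF z] dE[unfolded has_field_derivative_def]])
  then have en1: "(energy g c W has_derivative (\<lambda>k. - \<beta> (\<psi> z) * (fst k *\<^sub>R (- B z) + snd k *\<^sub>R A z))) (at z)"
    by (rule has_derivative_transform_within_open[OF _ open_inner z]) (metis E(1) inner_subset subsetD)
  have "(energy g c W has_derivative (\<lambda>k. (\<rho>x z * fst k + \<rho>y z * snd k) / 2 * ((u z - c)\<^sup>2 + (v z)\<^sup>2)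
      + \<rho> z / 2 * (2 * (u z - c) * (ux z * fst k + uy z * snd k) + 2 * v z * (vx z * fst k + vy z * snd k))
      + g * (snd k * \<rho> z + snd z * (\<rho>x z * fst k + \<rho>y z * snd k)) + (Px z * fst k + Py z * snd k))) (at z)"
    unfolding energy_def[abs_def]
    by (rule derivative_eq_intros du dv dP d\<rho> refl | simp)+ (simp add: fun_eq_iff algebra_simps)
  \<comment> \<open>Two expressions for the y-derivative of the energy: by the product rule, and
    through its dependence on psi alone.\<close>
  from has_derivative_py[OF this] has_derivative_py[OF en1]
  have en: "\<rho>y z / 2 * ((u z - c)\<^sup>2 + (v z)\<^sup>2) + \<rho> z * ((u z - c) * uy z + v z * vy z)
      + g * \<rho> z + g * snd z * \<rho>y z + Py z = - \<beta> (\<psi> z) * A z"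
    by (simp add: algebra_simps)
  have "((\<lambda>z. r (- \<psi> z)) has_derivative (\<lambda>k. r' * (- (fst k *\<^sub>R (- B z) + snd k *\<^sub>R A z)))) (at z)"
    by (rule has_derivative_compose[OF has_derivative_minus[OF psi_derivative_inner[OF z]] r'[unfolded has_field_derivative_def]])
  then have "(\<rho> has_derivative (\<lambda>k. r' * (- (fst k *\<^sub>R (- B z) + snd k *\<^sub>R A z)))) (at z)"
    by (rule has_derivative_transform_within_open[OF _ open_inner z]) (metis density_eq inner_subset subsetD)
  from has_derivative_py[OF this] has_derivative_py[OF d\<rho>] have \<rho>y: "\<rho>y z = - r' * A z" by simp
  have Az: "A z = s * (u z - c)" by (simp add: A_def s_def)
  \<comment> \<open>The factor A on the left supplies the u - c that turns the derivatives into
    terms of the momentum equation; it is negative and can be cancelled at the end.\<close>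
  have "2 * (A z * (py A z - px B z)) = (u z - c) * (2 * s * py A z - 2 * s * px B z)"
    by (simp add: Az algebra_simps)
  also have "\<dots> = \<rho>y z * (u z - c)\<^sup>2 + 2 * \<rho> z * (u z - c) * uy z - ((u z - c) * \<rho>x z) * v z
      - 2 * (\<rho> z * (u z - c) * vx z)"
    unfolding A' B' by (simp add: power2_eq_square algebra_simps)
  also have "(u z - c) * \<rho>x z = - (v z * \<rho>y z)" using eq(2) by linarith
  also have "\<rho> z * (u z - c) * vx z = - Py z - g * \<rho> z - \<rho> z * v z * vy z" using eq(3) by linarith
  also have "\<rho>y z * (u z - c)\<^sup>2 + 2 * \<rho> z * (u z - c) * uy z - (- (v z * \<rho>y z)) * v z
      - 2 * (- Py z - g * \<rho> z - \<rho> z * v z * vy z) = 2 * (- \<beta> (\<psi> z) * A z - g * snd z * \<rho>y z)"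
    unfolding en[symmetric] by (simp add: power2_eq_square algebra_simps)
  also have "\<dots> = 2 * (A z * (g * snd z * r' - \<beta> (\<psi> z)))"
    unfolding \<rho>y by (simp add: algebra_simps)
  finally show "py A z - px B z = g * snd z * r' - \<beta> (\<psi> z)"
    using A_neg[OF zD] by simp
qed

text \<open>The closed fluid over one period is the continuous image of a closed rectangle whose
  open interior is dense in it and is mapped into the cell. This covers the bed, the surface and the
  lines x = -pi and x = pi at once.\<close>

lemma vanish_on_closure:
  fixes f :: "real \<times> real \<Rightarrow> real"
  assumes f: "continuous_on D f" and 0: "\<And>z. z \<in> cell \<Longrightarrow> f z = 0"
    and xy: "(x, y) \<in> D" "x \<in> {- pi..pi}"
  shows "f (x, y) = 0"
proof -
  define M where "M z = (fst z, - d + snd z * (\<eta> (fst z) + d))" for z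
  let ?R = "{- pi<..<pi} \<times> {0<..<1 :: real}"
  have cl: "closure ?R = {- pi..pi} \<times> {0..1}"
    by (simp add: closure_Times)
  have pos: "0 < \<eta> x + d" for x using eta_gt[of x] by linarith
  have "M ` ({- pi..pi} \<times> {0..1}) \<subseteq> D"
  proof
    fix z assume "z \<in> M ` ({- pi..pi} \<times> {0..1})"
    then obtain a s where "z = M (a, s)" "(a, s) \<in> {- pi..pi} \<times> {0..1}"
      by (metis imageE surj_pair)
    then have z: "z = (a, - d + s * (\<eta> a + d))" and s: "0 \<le> s" "s \<le> 1"
      by (auto simp: M_def)
    have "0 \<le> s * (\<eta> a + d)" "s * (\<eta> a + d) \<le> 1 * (\<eta> a + d)"
      using s pos[of a] by (auto intro!: mult_right_mono)
    then show "z \<in> D" using z by (simp add: mem_fluid)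
  qed
  moreover have "continuous_on (({- pi..pi} \<times> {0..1})) M"
    unfolding M_def[abs_def] by (intro continuous_intros continuous_on_compose2[OF continuous_on_eta]) auto
  ultimately have "continuous_on (closure ?R) (\<lambda>z. f (M z))"
    unfolding cl by (intro continuous_on_compose2[OF f]) auto
  moreover have "f (M z) = 0" if "z \<in> ?R" for z
  proof (rule 0)
    obtain a s where z: "z = (a, s)" by (cases z)
    have s: "0 < s" "s < 1" "a \<in> {- pi<..<pi}" using that by (auto simp: z)
    have "0 < s * (\<eta> a + d)" "s * (\<eta> a + d) < 1 * (\<eta> a + d)"
      using s pos[of a] by (auto intro!: mult_strict_right_mono)
    then show "M z \<in> cell" using s by (simp add: z M_def cell_def inner_def)
  qed
  moreover define s where "s = (y + d) / (\<eta> x + d)"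
  have "M (x, s) = (x, y)" "(x, s) \<in> closure ?R"
    unfolding cl using xy pos[of x] by (auto simp: M_def s_def mem_fluid field_simps)
  ultimately show ?thesis
    using continuous_constant_on_closure[of ?R "\<lambda>z. f (M z)" 0 "(x, s)"] by auto
qed

section \<open>Periodicity, and the values of the data outside their intervals\<close>

lemma periodic: "periodic_wave d W"
  using steady by (simp add: steady_wave_def)

lemma periodic_fields:
  fixes m :: int
  assumes "(x, y) \<in> D" and f: "f \<in> {u, v, P}"
  shows "(x + 2 * pi * m, y) \<in> D" "f (x + 2 * pi * m, y) = f (x, y)"
    "\<eta> (x + 2 * pi * m) = \<eta> x"
proof -
  have \<eta>: "\<eta> (t + 2 * pi) = \<eta> t" for t
    using periodic by (simp add: periodic_wave_def)
  have f1: "f (t + 2 * pi, y) = f (t, y)" if "(t, y) \<in> D" for t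
    using periodic f that unfolding periodic_wave_def by blast
  have nat: "(t, y) \<in> D \<longrightarrow> f (t + 2 * pi * n, y) = f (t, y)" "\<eta> (t + 2 * pi * n) = \<eta> t" for t and n :: nat
  proof (induction n)
    case (Suc n)
    {
      case 1
      have "(t, y) \<in> D \<Longrightarrow> (t + 2 * pi * n, y) \<in> D" using Suc(2) by (simp add: mem_fluid)
      then show ?case using Suc(1) f1[of "t + 2 * pi * n"] by (auto simp: algebra_simps)
    next
      case 2
      then show ?case using Suc(2) \<eta>[of "t + 2 * pi * n"] by (simp add: algebra_simps)
    }
  qed auto
  \<comment> \<open>A shift to the left is undone by a natural number of periods started at the
    shifted point.\<close>
  have e: "\<eta> (t + 2 * pi * m) = \<eta> t" for t
    using nat(2)[of t "nat m"] nat(2)[of "t + 2 * pi * m" "nat (- m)"]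
    by (cases "m \<ge> 0") (simp_all add: algebra_simps)
  then show "\<eta> (x + 2 * pi * m) = \<eta> x" "(x + 2 * pi * m, y) \<in> D"
    using assms(1) by (simp_all add: mem_fluid)
  then show "f (x + 2 * pi * m, y) = f (x, y)"
    using nat(1)[of x "nat m"] nat(1)[of "x + 2 * pi * m" "nat (- m)"] assms(1)
    by (cases "m \<ge> 0") (simp_all add: algebra_simps)
qed

text \<open>Two waves with equal restricted data may still carry different total functions. Since
  psi takes values in [0, - p0] only, one pair of functions can serve both.\<close>

lemma change_data:
  assumes "\<And>p. p \<in> {p0..0} \<Longrightarrow> r' p = r p" "\<And>s. s \<in> {0..\<bar>p0\<bar>} \<Longrightarrow> \<beta>' s = \<beta> s"
  shows "symmetric_stratified_wave g d c Patm W \<psi> p0 r' \<beta>'"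
proof -
  have "- \<psi> z \<in> {p0..0}" if "z \<in> D" for z using psi_range[OF that] by auto
  then have "streamline_density d W \<psi> p0 r'"
    using strdens assms(1) unfolding streamline_density_def monotone_on_def by simp
  moreover have "bernoulli_function g d c W \<psi> p0 \<beta>'"
    using bernoulli assms(2) unfolding bernoulli_function_def by (metis (no_types, lifting))
  ultimately show ?thesis
    using steady stream flux classical symmetric by (simp add: symmetric_stratified_wave_def)
qed

end

section \<open>Two waves with the same data\<close>

lemma has_derivative_Complex:
  assumes "(a has_derivative a') F" "(b has_derivative b') F"
  shows "((\<lambda>z. Complex (a z) (b z)) has_derivative (\<lambda>k. Complex (a' k) (b' k))) F"
  using has_derivative_add[OF has_derivative_of_real[OF assms(1)]
      has_derivative_mult_right[OF has_derivative_of_real[OF assms(2)], of \<i>]]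
  by (simp add: Complex_eq)

locale two_waves =
  W1: symmetric_wave g d c Patm W1 \<psi>1 p0 r \<beta> +
  W2: symmetric_wave g d c Patm W2 \<psi>2 p0 r \<beta>
  for g d c Patm W1 \<psi>1 W2 \<psi>2 p0 r \<beta> +
  assumes r: "real_analytic_on r {p0..0}" and \<beta>: "real_analytic_on \<beta> {0..\<bar>p0\<bar>}"
    and crest: "profile W1 0 = profile W2 0"
    and axis: "\<And>y. y \<in> {- d..profile W1 0} \<Longrightarrow> hvel W1 (0, y) = hvel W2 (0, y)"
begin

text \<open>As long as the profiles may differ, both stream functions are defined and regular only
  on the common part of the two cells.\<close>

definition S where "S = W1.cell \<inter> W2.cell"
definition w where "w z = complex_of_real (\<psi>1 z - \<psi>2 z)"
definition f where "f z = Complex (W2.B z - W1.B z) (W2.A z - W1.A z)"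

lemma S_subset: "S \<subseteq> W1.inner" "S \<subseteq> W2.inner" "S \<subseteq> fluid d W1" "S \<subseteq> fluid d W2"
  using W1.cell_subset W2.cell_subset W1.inner_subset W2.inner_subset by (auto simp: S_def)

lemma open_S: "open S"
  unfolding S_def by (intro open_Int W1.open_cell W2.open_cell)

lemma psi_diff:
  assumes "z \<in> S"
  shows "\<psi>1 differentiable (at z)" "\<psi>2 differentiable (at z)"
  using assms S_subset W1.psi_derivative_inner W2.psi_derivative_inner differentiableI by blast+

lemma c1_AB: "c1 S W1.A" "c1 S W1.B" "c1 S W2.A" "c1 S W2.B"
  using W1.c1_AB W2.c1_AB by (auto simp: S_def intro: c1_subset)

lemma c1_w: "c1 S w"
proof -
  have "c1 S \<psi>1"
    by (rule c1I[OF W1.psi_derivative_inner])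
      (use S_subset(1) in \<open>auto intro!: continuous_on_minus c1_AB[THEN c1_continuous_on]\<close>)
  moreover have "c1 S \<psi>2"
    by (rule c1I[OF W2.psi_derivative_inner])
      (use S_subset(2) in \<open>auto intro!: continuous_on_minus c1_AB[THEN c1_continuous_on]\<close>)
  ultimately show ?thesis unfolding w_def[abs_def]
    by (intro c1_bounded_linear[OF bounded_linear_of_real] c1_diff)
qed

lemma partials_w:
  assumes "z \<in> S"
  shows "px w z = of_real (W2.B z - W1.B z)" "py w z = of_real (W1.A z - W2.A z)"
proof -
  have z: "z \<in> W1.inner" "z \<in> W2.inner" using assms S_subset by auto
  have d: "(\<lambda>z. \<psi>1 z - \<psi>2 z) differentiable (at z)"
    by (intro differentiable_diff psi_diff assms)
  show "px w z = of_real (W2.B z - W1.B z)" "py w z = of_real (W1.A z - W2.A z)"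
    unfolding w_def[abs_def] px_bounded_linear[OF bounded_linear_of_real d]
      px_diff[OF psi_diff[OF assms]] py_diff[OF psi_diff[OF assms]]
    using z by (simp_all add: W1.px_psi W2.px_psi W1.py_psi W2.py_psi)
qed

lemma dbar_w: "z \<in> S \<Longrightarrow> dbar w z = cnj (f z)"
  by (simp add: dbar_def partials_w f_def complex_eq_iff)

lemma f_alt: "f z = of_real (W2.B z - W1.B z) - of_real (W1.A z - W2.A z) * \<i>"
  by (simp add: f_def complex_eq_iff)

lemma c1_f: "c1 S f"
  unfolding f_alt[abs_def]
  by (intro c1_diff c1_mult c1_const c1_bounded_linear[OF bounded_linear_of_real] c1_AB)

text \<open>The real part is the difference of the two elliptic equations; the imaginary part is the
  difference of the two mixed derivative identities, hence 0.\<close>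

lemma dbar_f:
  assumes z: "z \<in> S"
    and r1: "(r has_real_derivative r1) (at (- \<psi>1 z))" and r2: "(r has_real_derivative r2) (at (- \<psi>2 z))"
  shows "dbar f z = of_real (g * snd z * (r1 - r2) - (\<beta> (\<psi>1 z) - \<beta> (\<psi>2 z)))"
proof -
  have "(f has_derivative (\<lambda>k. Complex
      ((fst k *\<^sub>R px W2.B z + snd k *\<^sub>R py W2.B z) - (fst k *\<^sub>R px W1.B z + snd k *\<^sub>R py W1.B z))
      ((fst k *\<^sub>R px W2.A z + snd k *\<^sub>R py W2.A z) - (fst k *\<^sub>R px W1.A z + snd k *\<^sub>R py W1.A z)))) (at z)"
    unfolding f_def[abs_def]
    by (intro has_derivative_Complex has_derivative_diff c1D[OF c1_AB(1) z] c1D[OF c1_AB(2) z]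
        c1D[OF c1_AB(3) z] c1D[OF c1_AB(4) z])
  from has_derivative_px[OF this] has_derivative_py[OF this]
  have "dbar f z = Complex ((px W2.B z - px W1.B z) - (py W2.A z - py W1.A z))
      ((px W2.A z - px W1.A z) + (py W2.B z - py W1.B z))"
    by (simp add: dbar_def complex_eq_iff)
  moreover have zi: "z \<in> W1.inner" "z \<in> W2.inner" using z S_subset by auto
  ultimately show ?thesis
    using W1.field_equations[OF zi(1) r1] W2.field_equations[OF zi(2) r2]
    by (simp add: complex_eq_iff algebra_simps)
qed

text \<open>Separation of variables: with H a primitive of 1 / sqrt(r(- s)), the function H(psi(0,
  y)) has derivative u - c, the same for both waves. H is strictly increasing, so no uniqueness
  theorem for differential equations is required.\<close>

lemma psi_axis:
  assumes y: "y \<in> {- d..profile W1 0}"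
  shows "\<psi>1 (0, y) = \<psi>2 (0, y)"
proof -
  have rc: "continuous_on {p0..0} r" by (rule real_analytic_on_continuous[OF r])
  have rpos: "r p > 0" if "p \<in> {p0..0}" for p
    using W1.strdens that by (simp add: streamline_density_def)
  define k where "k s = 1 / sqrt (r (- s))" for s
  have kpos: "k s > 0" if "s \<in> {0..- p0}" for s
    using rpos[of "- s"] that by (auto simp: k_def)
  have "sqrt (r (- s)) \<noteq> 0" if "s \<in> {0..- p0}" for s
    using rpos[of "- s"] that by auto
  then have kc: "continuous_on {0..- p0} k"
    unfolding k_def[abs_def]
    by (intro continuous_intros continuous_on_compose2[OF rc] ballI) auto
  define H where "H s = integral {0..s} k" for s
  have H: "(H has_real_derivative k s) (at s within {0..- p0})" if "s \<in> {0..- p0}" for s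
    unfolding H_def[abs_def] by (rule integral_has_real_derivative[OF kc that])
  have H_mono: "H s < H t" if "0 \<le> s" "s < t" "t \<le> - p0" for s t
  proof (rule DERIV_pos_imp_increasing_open[OF that(2)])
    fix x assume x: "s < x" "x < t"
    then have "at x within {0..- p0} = at x" using that by (intro at_within_interior) auto
    then show "\<exists>y. (H has_real_derivative y) (at x) \<and> 0 < y"
      using H[of x] kpos[of x] x that by auto
  next
    show "continuous_on {s..t} H"
      by (rule continuous_on_subset[OF DERIV_continuous_on[OF H]]) (use that in auto)
  qed
  let ?I = "{- d..profile W1 0}"
  have deriv: "((\<lambda>t. H (\<psi> (0, t))) has_real_derivative hvel W (0, t) - c) (at t within ?I)"
    if "t \<in> ?I" "\<psi> (0, t) \<in> {0..- p0}" "(\<lambda>t. \<psi> (0, t)) ` ?I \<subseteq> {0..- p0}"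
      "((\<lambda>t. \<psi> (0, t)) has_real_derivative sqrt (r (- \<psi> (0, t))) * (hvel W (0, t) - c)) (at t within ?I)" for \<psi> W t
  proof -
    have "(H has_real_derivative k (\<psi> (0, t))) (at (\<psi> (0, t)) within (\<lambda>t. \<psi> (0, t)) ` ?I)"
      by (rule DERIV_subset[OF H[OF that(2)] that(3)])
    from DERIV_image_chain[OF this that(4)]
    have "((\<lambda>t. H (\<psi> (0, t))) has_real_derivative
        k (\<psi> (0, t)) * (sqrt (r (- \<psi> (0, t))) * (hvel W (0, t) - c))) (at t within ?I)"
      by (simp add: o_def)
    moreover have "sqrt (r (- \<psi> (0, t))) > 0" using rpos[of "- \<psi> (0, t)"] that(2) by auto
    ultimately show ?thesis by (simp add: k_def)
  qed
  have D: "(0, t) \<in> fluid d W1" "(0, t) \<in> fluid d W2" if "t \<in> ?I" for t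
    using that crest by (auto simp: fluid_def)
  have "((\<lambda>t. H (\<psi>1 (0, t)) - H (\<psi>2 (0, t))) has_real_derivative 0) (at t within ?I)" if t: "t \<in> ?I" for t
  proof -
    have "((\<lambda>t. H (\<psi>1 (0, t))) has_real_derivative hvel W1 (0, t) - c) (at t within ?I)"
      using W1.psi_vertical[OF t] W1.density_eq[OF D(1)[OF t]]
      by (intro deriv t W1.psi_range D) (auto intro!: W1.psi_range D simp: W1.A_def simp del: atLeastAtMost_iff)
    moreover have "((\<lambda>t. H (\<psi>2 (0, t))) has_real_derivative hvel W2 (0, t) - c) (at t within ?I)"
      using W2.psi_vertical[of t 0] t crest W2.density_eq[OF D(2)[OF t]]
      by (intro deriv t W2.psi_range D) (auto intro!: W2.psi_range D simp: W2.A_def simp del: atLeastAtMost_iff)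
    ultimately show ?thesis
      using axis[OF t] by (auto intro!: derivative_eq_intros)
  qed
  then obtain C where C: "\<And>t. t \<in> ?I \<Longrightarrow> H (\<psi>1 (0, t)) - H (\<psi>2 (0, t)) = C"
    using has_field_derivative_zero_constant[of ?I "\<lambda>t. H (\<psi>1 (0, t)) - H (\<psi>2 (0, t))"] convex_closed_interval
    by blast
  \<comment> \<open>The constant is read off at the common crest, where both stream functions are
    0.\<close>
  have "C = 0"
    using C[of "profile W1 0"] W1.eta_gt[of 0] W1.psi_surface[of 0] W2.psi_surface[of 0] crest by auto
  then have "H (\<psi>1 (0, y)) = H (\<psi>2 (0, y))" using C[OF y] by simp
  then show ?thesis
    using H_mono[of "\<psi>1 (0, y)" "\<psi>2 (0, y)"] H_mono[of "\<psi>2 (0, y)" "\<psi>1 (0, y)"]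
      W1.psi_range[OF D(1)[OF y]] W2.psi_range[OF D(2)[OF y]]
    by (cases "\<psi>1 (0, y)" "\<psi>2 (0, y)" rule: linorder_cases) auto
qed

lemma derivative_r:
  assumes "z \<in> W1.inner"
  obtains r1 where "(r has_real_derivative r1) (at (- \<psi>1 z))"
proof -
  have "p0 < - \<psi>1 z" "- \<psi>1 z < 0" using W1.psi_inner[OF assms] by auto
  then obtain r' e where e: "(0::real) < e" and
    r': "\<And>y. y \<in> {- \<psi>1 z - e..- \<psi>1 z + e} \<Longrightarrow> (r has_real_derivative r' y) (at y)"
    using real_analytic_on_interior[OF r] by metis
  then show thesis using that[of "r' (- \<psi>1 z)"] by simp
qed

text \<open>The gradient of w is made of the components of f, which vanish on the axis by
  \<open>psi_axis\<close> and \<open>B_axis\<close>. For f, the derivative along the axis is 0, and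
  dbar f = 0 because equal values of psi make the right-hand sides of both elliptic equations equal;
  together they force px f = 0.\<close>

lemma axis_zero:
  assumes z: "z \<in> S" "fst z = 0"
  shows "w z = 0 \<and> px w z = 0 \<and> py w z = 0" "f z = 0 \<and> px f z = 0 \<and> py f z = 0"
proof -
  have on_axis: "w (0, t) = 0 \<and> f (0, t) = 0" if t: "(0, t) \<in> S" for t
  proof -
    have D: "(0, t) \<in> fluid d W1" "(0, t) \<in> fluid d W2" using t S_subset by auto
    then have tI: "t \<in> {- d..profile W1 0}" by (auto simp: fluid_def)
    have p: "\<psi>1 (0, t) = \<psi>2 (0, t)" by (rule psi_axis[OF tI])
    have "W1.A (0, t) = W2.A (0, t)"
      using W1.density_eq[OF D(1)] W2.density_eq[OF D(2)] p axis[OF tI] by (simp add: W1.A_def W2.A_def)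
    moreover have "W1.B (0, t) = 0" "W2.B (0, t) = 0"
      using t S_subset by (auto intro!: W1.B_axis W2.B_axis)
    ultimately show ?thesis using p by (simp add: w_def f_def complex_eq_iff)
  qed
  obtain y where y: "z = (0, y)" using z(2) by (cases z) auto
  have w0: "w z = 0" and f0: "f z = 0" using on_axis z(1) y by auto
  have "px w z = 0" "py w z = 0"
    using f0 partials_w[OF z(1)] by (auto simp: f_def complex_eq_iff)
  then show "w z = 0 \<and> px w z = 0 \<and> py w z = 0" using w0 by simp
  have "open ((\<lambda>t. (0, t)) -` S)"
    by (intro open_vimage open_S continuous_intros)
  then have "((\<lambda>t. f (0, t)) has_vector_derivative 0) (at y)"
    by (rule has_vector_derivative_transform_within_open[OF has_vector_derivative_const])
      (use z y on_axis in auto)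
  moreover have "((\<lambda>t. f (0, t)) has_vector_derivative py f z) (at y)"
    unfolding y by (rule has_vector_derivative_py) (use c1_differentiable[OF c1_f z(1)] y in simp)
  ultimately have pyf: "py f z = 0" using vector_derivative_unique_at by blast
  obtain r1 where r1: "(r has_real_derivative r1) (at (- \<psi>1 z))"
    using derivative_r[of z] z S_subset by blast
  have "\<psi>1 z = \<psi>2 z" using w0 by (simp add: w_def)
  then have "dbar f z = 0" using dbar_f[OF z(1) r1, of r1] r1 by simp
  then show "f z = 0 \<and> px f z = 0 \<and> py f z = 0" using f0 pyf by (simp add: dbar_def)
qed

text \<open>At a zero of w both stream functions take the same value, so near that point their
  values lie in one interval on which r' and \<open>\<beta>\<close> are Lipschitz. In the constant,
  1 accounts for |dbar w| = |f| and Y^2 for |dbar f| <= Y |w|.\<close>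

lemma local_bound:
  assumes z: "z \<in> S" and w0: "w z = 0"
  shows "\<exists>C. \<exists>e>0. ball z e \<subseteq> S \<and> (\<forall>x\<in>ball z e. (cmod (dbar f x))\<^sup>2 + (cmod (dbar w x))\<^sup>2
      \<le> C * ((cmod (f x))\<^sup>2 + (cmod (w x))\<^sup>2))"
proof -
  define s where "s = \<psi>1 z"
  have s: "\<psi>1 z = s" "\<psi>2 z = s" using w0 by (simp_all add: s_def w_def)
  have sr: "0 < s" "s < \<bar>p0\<bar>" "p0 < - s" "- s < 0"
    using W1.psi_inner[of z] z S_subset by (auto simp: s_def)
  obtain r' K1 e1 where e1: "0 < e1" "{- s - e1..- s + e1} \<subseteq> {p0<..<0}" and
    r': "\<And>y. y \<in> {- s - e1..- s + e1} \<Longrightarrow> (r has_real_derivative r' y) (at y)" and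
    "\<And>y z. y \<in> {- s - e1..- s + e1} \<Longrightarrow> z \<in> {- s - e1..- s + e1} \<Longrightarrow> \<bar>r y - r z\<bar> \<le> K1 * \<bar>y - z\<bar>" and
    K1: "\<And>y z. y \<in> {- s - e1..- s + e1} \<Longrightarrow> z \<in> {- s - e1..- s + e1} \<Longrightarrow> \<bar>r' y - r' z\<bar> \<le> K1 * \<bar>y - z\<bar>"
    by (rule real_analytic_on_interior[OF r sr(3,4)]) (rule that)
  obtain \<beta>' K2 e2 where e2: "0 < e2" "{s - e2..s + e2} \<subseteq> {0<..<\<bar>p0\<bar>}" and
    "\<And>y. y \<in> {s - e2..s + e2} \<Longrightarrow> (\<beta> has_real_derivative \<beta>' y) (at y)" and
    K2: "\<And>y z. y \<in> {s - e2..s + e2} \<Longrightarrow> z \<in> {s - e2..s + e2} \<Longrightarrow> \<bar>\<beta> y - \<beta> z\<bar> \<le> K2 * \<bar>y - z\<bar>" and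
    "\<And>y z. y \<in> {s - e2..s + e2} \<Longrightarrow> z \<in> {s - e2..s + e2} \<Longrightarrow> \<bar>\<beta>' y - \<beta>' z\<bar> \<le> K2 * \<bar>y - z\<bar>"
    by (rule real_analytic_on_interior[OF \<beta> sr(1,2)]) (rule that)
  define m where "m = min e1 e2"
  have m: "0 < m" using e1 e2 by (simp add: m_def)
  have cont: "continuous_on S \<psi>1" "continuous_on S \<psi>2"
    using continuous_on_subset[OF W1.continuous_on_psi S_subset(3)]
      continuous_on_subset[OF W2.continuous_on_psi S_subset(4)] by auto
  have "open (S \<inter> \<psi>1 -` {s - m<..<s + m})" "open (S \<inter> \<psi>2 -` {s - m<..<s + m})"
    by (intro continuous_open_preimage cont open_S open_greaterThanLessThan)+
  then have "open ((S \<inter> \<psi>1 -` {s - m<..<s + m}) \<inter> (S \<inter> \<psi>2 -` {s - m<..<s + m}))" by (rule open_Int)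
  moreover have "z \<in> (S \<inter> \<psi>1 -` {s - m<..<s + m}) \<inter> (S \<inter> \<psi>2 -` {s - m<..<s + m})"
    using z s m by simp
  ultimately obtain e where e: "e > 0"
    "ball z e \<subseteq> (S \<inter> \<psi>1 -` {s - m<..<s + m}) \<inter> (S \<inter> \<psi>2 -` {s - m<..<s + m})"
    using open_contains_ball by meson
  define Y where "Y = \<bar>g\<bar> * (\<bar>snd z\<bar> + e) * K1 + K2"
  \<comment> \<open>A Lipschitz bound between two distinct points forces a nonnegative constant,
    which the monotonicity steps below rely on.\<close>
  have "0 \<le> K1 * \<bar>- s - (- s + e1)\<bar>" "0 \<le> K2 * \<bar>s - (s + e2)\<bar>"
    by (rule order_trans[OF abs_ge_zero K1] order_trans[OF abs_ge_zero K2]; use e1 e2 in simp)+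
  then have K0: "0 \<le> K1" "0 \<le> K2" using e1 e2 by (simp_all add: zero_le_mult_iff)
  have "(cmod (dbar f x))\<^sup>2 + (cmod (dbar w x))\<^sup>2 \<le> (1 + Y\<^sup>2) * ((cmod (f x))\<^sup>2 + (cmod (w x))\<^sup>2)"
    if x: "x \<in> ball z e" for x
  proof -
    have xS: "x \<in> S" using x e(2) by blast
    have "\<psi>1 x \<in> {s - m<..<s + m}" "\<psi>2 x \<in> {s - m<..<s + m}" using x e(2) by auto
    then have I: "\<psi>1 x \<in> {s - e2..s + e2}" "\<psi>2 x \<in> {s - e2..s + e2}"
      "- \<psi>1 x \<in> {- s - e1..- s + e1}" "- \<psi>2 x \<in> {- s - e1..- s + e1}"
      by (auto simp: m_def)
    have sx: "\<bar>snd x\<bar> \<le> \<bar>snd z\<bar> + e"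
      using x dist_snd_le[of z x] by (auto simp: dist_real_def)
    have "cmod (dbar f x) = \<bar>g * snd x * (r' (- \<psi>1 x) - r' (- \<psi>2 x)) - (\<beta> (\<psi>1 x) - \<beta> (\<psi>2 x))\<bar>"
      unfolding dbar_f[OF xS r'[OF I(3)] r'[OF I(4)]] by (rule norm_of_real)
    also have "\<dots> \<le> \<bar>g\<bar> * \<bar>snd x\<bar> * \<bar>r' (- \<psi>1 x) - r' (- \<psi>2 x)\<bar> + \<bar>\<beta> (\<psi>1 x) - \<beta> (\<psi>2 x)\<bar>"
      using abs_triangle_ineq4 by (metis abs_mult)
    also have "\<dots> \<le> \<bar>g\<bar> * (\<bar>snd z\<bar> + e) * (K1 * \<bar>\<psi>1 x - \<psi>2 x\<bar>) + K2 * \<bar>\<psi>1 x - \<psi>2 x\<bar>"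
      using K1[OF I(3,4)] K2[OF I(1,2)] sx e(1)
      by (intro add_mono mult_mono mult_nonneg_nonneg) (auto simp: abs_minus_commute)
    also have "\<dots> = Y * cmod (w x)"
      by (simp add: Y_def w_def algebra_simps flip: of_real_diff)
    finally have "(cmod (dbar f x))\<^sup>2 \<le> (Y * cmod (w x))\<^sup>2" by (intro power_mono) auto
    moreover have "(cmod (dbar w x))\<^sup>2 = (cmod (f x))\<^sup>2" using dbar_w[OF xS] by simp
    moreover have "0 \<le> Y\<^sup>2 * (cmod (f x))\<^sup>2" "0 \<le> (cmod (w x))\<^sup>2" by auto
    ultimately show ?thesis
      unfolding power_mult_distrib distrib_left distrib_right mult_1_left by linarith
  qed
  moreover have "ball z e \<subseteq> S" using e(2) by blast
  ultimately show ?thesis using e(1) by blast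
qed

lemma connected_S: "connected S"
proof -
  have "S = {z. fst z \<in> {- pi<..<pi} \<and> - d < snd z \<and> snd z < min (profile W1 (fst z)) (profile W2 (fst z))}"
    by (auto simp: S_def W1.cell_def W2.cell_def W1.inner_def W2.inner_def)
  then show ?thesis
    using W1.eta_gt W2.eta_gt
    by (simp only:) (intro connected_under_graph continuous_intros W1.continuous_on_eta W2.continuous_on_eta; simp)
qed

text \<open>Extension by zero creates the open set of zeros from which the continuation starts, at
  the price of losing information about x < 0. At points of the axis the inequality for the extended
  pair is inherited from \<open>local_bound\<close>, because both sides are 0 on the left half of
  the ball.\<close>

lemma unique_continuation:
  assumes "z \<in> S" "fst z > 0"
  shows "\<psi>1 z = \<psi>2 z"
proof -
  define f0 where "f0 z = (if fst z \<le> 0 then 0 else f z)" for z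
  define w0 where "w0 z = (if fst z \<le> 0 then 0 else w z)" for z
  note F = c1_extend_zero[OF c1_f open_S axis_zero(2), folded f0_def[abs_def]]
    px_extend_zero[OF c1_f open_S axis_zero(2), folded f0_def[abs_def]]
    py_extend_zero[OF c1_f open_S axis_zero(2), folded f0_def[abs_def]]
  note W = c1_extend_zero[OF c1_w open_S axis_zero(1), folded w0_def[abs_def]]
    px_extend_zero[OF c1_w open_S axis_zero(1), folded w0_def[abs_def]]
    py_extend_zero[OF c1_w open_S axis_zero(1), folded w0_def[abs_def]]
  have dF: "dbar f0 z = (if fst z \<le> 0 then 0 else dbar f z)"
    and dW: "dbar w0 z = (if fst z \<le> 0 then 0 else dbar w z)" if "z \<in> S" for z
    using F W that by (auto simp: dbar_def)
  define V where "V = S \<inter> {z. fst z < 0}"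
  have "f0 z = 0 \<and> w0 z = 0"
  proof (rule dbar_unique_continuation[OF F(1) W(1) open_S connected_S])
    fix z assume z: "z \<in> S" "w0 z = 0"
    show "\<exists>C. \<exists>e>0. \<forall>x\<in>ball z e. (cmod (dbar f0 x))\<^sup>2 + (cmod (dbar w0 x))\<^sup>2
        \<le> C * ((cmod (f0 x))\<^sup>2 + (cmod (w0 x))\<^sup>2)"
    proof (cases "fst z < 0")
      case True
      have "open V" unfolding V_def by (intro open_Int open_S open_Collect_less continuous_intros)
      then obtain e where e: "e > 0" "ball z e \<subseteq> V"
        using True z(1) open_contains_ball by (metis (no_types, lifting) V_def IntI mem_Collect_eq)
      then have "dbar f0 x = 0 \<and> dbar w0 x = 0" if "x \<in> ball z e" for x
        using that dF[of x] dW[of x] by (force simp: V_def)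
      then show ?thesis using e(1) by (intro exI[of _ 0] exI[of _ e]) simp
    next
      case False
      then have "w z = 0" using z axis_zero(1)[OF z(1)] by (cases "fst z = 0") (auto simp: w0_def)
      then obtain C e where e: "e > 0" "ball z e \<subseteq> S" and C: "\<And>x. x \<in> ball z e \<Longrightarrow>
          (cmod (dbar f x))\<^sup>2 + (cmod (dbar w x))\<^sup>2 \<le> C * ((cmod (f x))\<^sup>2 + (cmod (w x))\<^sup>2)"
        using local_bound[OF z(1)] by blast
      have "(cmod (dbar f0 x))\<^sup>2 + (cmod (dbar w0 x))\<^sup>2 \<le> C * ((cmod (f0 x))\<^sup>2 + (cmod (w0 x))\<^sup>2)"
        if x: "x \<in> ball z e" for x
      proof -
        have "x \<in> S" using x e(2) by blast
        then show ?thesis using C[OF x] by (simp add: dF dW f0_def w0_def)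
      qed
      then show ?thesis using e(1) by blast
    qed
  next
    show "open V" unfolding V_def by (intro open_Int open_S open_Collect_less continuous_intros)
    show "V \<subseteq> S" "\<And>z. z \<in> V \<Longrightarrow> f0 z = 0 \<and> w0 z = 0"
      by (auto simp: V_def f0_def w0_def)
    \<comment> \<open>A point midway between the bed and the lower surface above x = -1, an abscissa
      inside the period.\<close>
    define y where "y = (- d + min (profile W1 (- 1)) (profile W2 (- 1))) / 2"
    have "(- 1, y) \<in> V"
      using W1.eta_gt[of "- 1"] W2.eta_gt[of "- 1"] pi_gt3
      by (auto simp: V_def S_def W1.cell_def W2.cell_def W1.inner_def W2.inner_def y_def min_def)
    then show "V \<noteq> {}" by blast
    show "z \<in> S" by (rule assms(1))
  qed
  then show ?thesis using assms by (simp add: w0_def w_def)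
qed

text \<open>The left half, discarded by the extension, is regained by reflecting both waves in the
  axis.\<close>

lemma psi_eq: "z \<in> S \<Longrightarrow> \<psi>1 z = \<psi>2 z"
proof -
  assume z: "z \<in> S"
  obtain x y where xy: "z = (x, y)" by (cases z)
  have D: "(x, y) \<in> fluid d W1" "(x, y) \<in> fluid d W2" using z xy S_subset by auto
  consider "x > 0" | "x = 0" | "x < 0" by linarith
  then show ?thesis
  proof cases
    case 1 then show ?thesis using unique_continuation[OF z] xy by simp
  next
    case 2 then show ?thesis using axis_zero(1)[OF z] xy by (simp add: w_def)
  next
    case 3
    have "profile W x = profile W (- x)" if "symmetric_wave g d c Patm W \<psi> p0 r \<beta>" for W \<psi>
    proof -
      interpret symmetric_wave g d c Patm W \<psi> p0 r \<beta> by fact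
      show ?thesis
        using reflection(1)[of x "profile W x"] reflection(1)[of "- x" "profile W (- x)"] eta_gt[of x] eta_gt[of "- x"]
        by (simp add: mem_fluid)
    qed
    from this[OF W1.symmetric_wave_axioms] this[OF W2.symmetric_wave_axioms]
    have "(- x, y) \<in> S"
      using z xy by (auto simp: S_def W1.cell_def W2.cell_def W1.inner_def W2.inner_def)
    then have "\<psi>1 (- x, y) = \<psi>2 (- x, y)" using 3 unique_continuation by simp
    then show ?thesis using W1.reflection(2)[OF D(1)] W2.reflection(2)[OF D(2)] xy by simp
  qed
qed

end

text \<open>If this surface lay strictly below the other, then at its height psi would be 0 while
  psi' is still positive, although continuity makes the two agree there. Treating one wave against
  another lets the argument run in both directions.\<close>

lemma (in symmetric_wave) profile_not_less:
  assumes W': "symmetric_wave g d c Patm W' \<psi>' p0 r \<beta>"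
    and eq: "\<And>y. - d < y \<Longrightarrow> y < \<eta> x \<Longrightarrow> y < profile W' x \<Longrightarrow> \<psi> (x, y) = \<psi>' (x, y)"
  shows "\<not> \<eta> x < profile W' x"
proof
  interpret W': symmetric_wave g d c Patm W' \<psi>' p0 r \<beta> by fact
  assume less: "\<eta> x < profile W' x"
  have "continuous_on {- d..\<eta> x} (\<lambda>y. \<psi> (x, y) - \<psi>' (x, y))"
    by (intro continuous_intros continuous_on_compose2[OF continuous_on_psi]
        continuous_on_compose2[OF W'.continuous_on_psi]) (use less in \<open>auto simp: mem_fluid W'.mem_fluid\<close>)
  moreover have "closure {- d<..<\<eta> x} = {- d..\<eta> x}" using eta_gt[of x] by simp
  moreover have "\<psi> (x, y) - \<psi>' (x, y) = 0" if "y \<in> {- d<..<\<eta> x}" for y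
    using eq[of y] that less by simp
  ultimately have "\<psi> (x, \<eta> x) - \<psi>' (x, \<eta> x) = 0"
    using continuous_constant_on_closure[of "{- d<..<\<eta> x}" "\<lambda>y. \<psi> (x, y) - \<psi>' (x, y)" 0 "\<eta> x"]
      eta_gt[of x] by simp
  moreover have "\<psi>' (x, \<eta> x) > 0"
    using W'.psi_inner[of "(x, \<eta> x)"] less eta_gt[of x] by (simp add: W'.inner_def)
  ultimately show False by (simp add: psi_surface)
qed

section \<open>Equality of profiles, velocities and pressures\<close>

context two_waves
begin

lemma profile_eq_open:
  assumes x: "x \<in> {- pi<..<pi}"
  shows "profile W1 x = profile W2 x"
proof -
  have eq: "\<psi>1 (x, y) = \<psi>2 (x, y)" if "- d < y" "y < profile W1 x" "y < profile W2 x" for y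
    using that x by (intro psi_eq) (simp add: S_def W1.cell_def W2.cell_def W1.inner_def W2.inner_def)
  have "\<not> profile W1 x < profile W2 x"
    by (rule W1.profile_not_less[OF W2.symmetric_wave_axioms eq])
  moreover have "\<not> profile W2 x < profile W1 x"
    by (rule W2.profile_not_less[OF W1.symmetric_wave_axioms eq[symmetric]])
  ultimately show ?thesis by linarith
qed

lemma shift_into_cell:
  obtains m :: int where "x + 2 * pi * m \<in> {- pi..pi}"
proof -
  define t where "t = (x + pi) / (2 * pi)"
  have x: "x = 2 * pi * t - pi" by (simp add: t_def field_simps)
  have "0 \<le> t - of_int \<lfloor>t\<rfloor>" "t - of_int \<lfloor>t\<rfloor> \<le> 1" by linarith+
  then have "2 * pi * (t - of_int \<lfloor>t\<rfloor>) \<ge> 0" "2 * pi * (t - of_int \<lfloor>t\<rfloor>) \<le> 2 * pi * 1"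
    by (simp_all add: mult_left_mono)
  then have "x + 2 * pi * of_int (- \<lfloor>t\<rfloor>) \<in> {- pi..pi}"
    by (simp add: x algebra_simps)
  then show thesis by (rule that)
qed

text \<open>Continuity adds the end points of the period, periodicity all other x.\<close>

lemma profile_eq: "profile W1 = profile W2"
proof (rule ext)
  fix x :: real
  have closed: "profile W1 t = profile W2 t" if "t \<in> {- pi..pi}" for t
  proof -
    have "profile W1 t - profile W2 t = 0"
    proof (rule continuous_constant_on_closure[of "{- pi<..<pi}" "\<lambda>t. profile W1 t - profile W2 t"])
      show "continuous_on (closure {- pi<..<pi}) (\<lambda>t. profile W1 t - profile W2 t)"
        by (intro continuous_intros W1.continuous_on_eta W2.continuous_on_eta)
    qed (use that profile_eq_open in auto)
    then show ?thesis by simp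
  qed
  obtain m :: int where m: "x + 2 * pi * m \<in> {- pi..pi}" by (rule shift_into_cell)
  have "(x, - d) \<in> fluid d W1" "(x, - d) \<in> fluid d W2"
    using W1.eta_gt[of x] W2.eta_gt[of x] by (auto simp: fluid_def)
  then show "profile W1 x = profile W2 x"
    using closed[OF m] W1.periodic_fields(3)[of x "- d" "hvel W1" m] W2.periodic_fields(3)[of x "- d" "hvel W2" m]
    by simp
qed

lemma fluid_eq: "fluid d W1 = fluid d W2"
  by (simp add: fluid_def profile_eq)

lemma cell_eq: "W1.cell = S" "W2.cell = S"
  by (auto simp: S_def W1.cell_def W2.cell_def W1.inner_def W2.inner_def profile_eq)

lemma continuous_velocity:
  "continuous_on (fluid d W1) (hvel W1)" "continuous_on (fluid d W1) (vvel W1)"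
  "continuous_on (fluid d W2) (hvel W2)" "continuous_on (fluid d W2) (vvel W2)"
  by (rule W1.continuous_on_velocity W2.continuous_on_velocity)+

lemma eq_in_cell:
  assumes z: "z \<in> S"
  shows "hvel W1 z = hvel W2 z" "vvel W1 z = vvel W2 z"
proof -
  have zi: "z \<in> W1.inner" "z \<in> W2.inner" "z \<in> fluid d W1" "z \<in> fluid d W2" using z S_subset by auto
  have \<rho>: "density W1 z = density W2 z"
    using W1.density_eq[OF zi(3)] W2.density_eq[OF zi(4)] psi_eq[OF z] by simp
  have s: "sqrt (density W2 z) > 0" using W2.density_pos[OF zi(4)] by simp
  have "px \<psi>1 z = px \<psi>2 z" "py \<psi>1 z = py \<psi>2 z"
    using px_cong(1,2)[OF open_S z psi_eq] by auto
  then have "W1.A z = W2.A z" "W1.B z = W2.B z"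
    using zi by (simp_all add: W1.px_psi W2.px_psi W1.py_psi W2.py_psi)
  then show "hvel W1 z = hvel W2 z" "vvel W1 z = vvel W2 z"
    using \<rho> s by (simp_all add: W1.A_def W2.A_def W1.B_def W2.B_def)
qed

text \<open>Once the profiles agree, both cells equal \<open>S\<close> and both fluids coincide, so
  equality extends by continuity. The density follows from psi through the streamline
  density.\<close>

lemma eq_in_period:
  assumes "(x, y) \<in> fluid d W1" "x \<in> {- pi..pi}"
  shows "\<psi>1 (x, y) = \<psi>2 (x, y)" "hvel W1 (x, y) = hvel W2 (x, y)" "vvel W1 (x, y) = vvel W2 (x, y)"
    "density W1 (x, y) = density W2 (x, y)"
proof -
  have z: "k1 (x, y) = k2 (x, y)"
    if "continuous_on (fluid d W1) k1" "continuous_on (fluid d W2) k2" "\<And>z. z \<in> S \<Longrightarrow> k1 z = k2 z"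
    for k1 k2 :: "real \<times> real \<Rightarrow> real"
    using W1.vanish_on_closure[of "\<lambda>z. k1 z - k2 z", OF _ _ assms] that fluid_eq cell_eq
    by (simp add: continuous_on_diff)
  show "hvel W1 (x, y) = hvel W2 (x, y)" "vvel W1 (x, y) = vvel W2 (x, y)"
    by (rule z[OF continuous_velocity(1,3) eq_in_cell(1)] z[OF continuous_velocity(2,4) eq_in_cell(2)]; assumption)+
  show p: "\<psi>1 (x, y) = \<psi>2 (x, y)"
    by (rule z[OF W1.continuous_on_psi W2.continuous_on_psi psi_eq])
  show "density W1 (x, y) = density W2 (x, y)"
    using W1.density_eq[OF assms(1)] W2.density_eq[of "(x, y)"] assms(1) fluid_eq p by simp
qed

text \<open>The Bernoulli function fixes E only up to an additive constant. At the crest the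
  pressure is \<open>Patm\<close> for both waves and the other terms of the energy agree, so that
  constant is the same, and the pressure is then the only unknown term of the energy.\<close>

lemma pressure_eq_in_period:
  assumes xy: "(x, y) \<in> fluid d W1" "x \<in> {- pi..pi}"
  shows "pressure W1 (x, y) = pressure W2 (x, y)"
proof -
  let ?I = "{0..\<bar>p0\<bar>}"
  obtain E1 where E1: "\<And>z. z \<in> fluid d W1 \<Longrightarrow> energy g c W1 z = E1 (\<psi>1 z)"
    "\<And>s. s \<in> ?I \<Longrightarrow> (E1 has_real_derivative - \<beta> s) (at s within ?I)"
    using W1.bernoulli unfolding bernoulli_function_def by blast
  obtain E2 where E2: "\<And>z. z \<in> fluid d W2 \<Longrightarrow> energy g c W2 z = E2 (\<psi>2 z)"
    "\<And>s. s \<in> ?I \<Longrightarrow> (E2 has_real_derivative - \<beta> s) (at s within ?I)"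
    using W2.bernoulli unfolding bernoulli_function_def by blast
  have "((\<lambda>s. E1 s - E2 s) has_real_derivative 0) (at s within ?I)" if "s \<in> ?I" for s
    using E1(2)[OF that] E2(2)[OF that] by (auto intro!: derivative_eq_intros)
  then obtain C where C: "\<And>s. s \<in> ?I \<Longrightarrow> E1 s - E2 s = C"
    using has_field_derivative_zero_constant[of ?I "\<lambda>s. E1 s - E2 s"] convex_closed_interval by blast
  let ?t = "(0, profile W1 0)"
  have t: "?t \<in> fluid d W1" "0 \<in> {- pi..pi}" using W1.eta_gt[of 0] by (auto simp: fluid_def)
  have "boundary_conditions d c Patm W1" "boundary_conditions d c Patm W2"
    using W1.steady W2.steady by (simp_all add: steady_wave_def)
  then have "pressure W1 ?t = Patm" "pressure W2 (0, profile W2 0) = Patm"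
    by (simp_all add: boundary_conditions_def)
  then have "pressure W1 ?t = pressure W2 ?t" using crest by simp
  then have "energy g c W1 ?t = energy g c W2 ?t"
    using eq_in_period[OF t] by (simp add: energy_def)
  moreover have "\<psi>1 ?t = 0" "\<psi>2 ?t = 0" using W1.psi_surface[of 0] W2.psi_surface[of 0] crest by auto
  ultimately have "E1 0 = E2 0" using E1(1)[OF t(1)] E2(1)[of ?t] t(1) fluid_eq by simp
  then have "C = 0" using C[of 0] by simp
  moreover have "\<psi>1 (x, y) \<in> ?I" using W1.psi_range[OF xy(1)] by auto
  ultimately have "E1 (\<psi>1 (x, y)) = E2 (\<psi>1 (x, y))" using C by force
  then have "energy g c W1 (x, y) = energy g c W2 (x, y)"
    using E1(1)[OF xy(1)] E2(1)[of "(x, y)"] xy(1) fluid_eq eq_in_period(1)[OF xy] by simp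
  then show ?thesis using eq_in_period[OF xy] by (simp add: energy_def)
qed

lemma fields_eq:
  assumes "z \<in> fluid d W1"
  shows "hvel W1 z = hvel W2 z" "vvel W1 z = vvel W2 z" "pressure W1 z = pressure W2 z"
proof -
  obtain x y where z: "z = (x, y)" by (cases z)
  obtain m :: int where m: "x + 2 * pi * m \<in> {- pi..pi}" by (rule shift_into_cell)
  have D: "(x, y) \<in> fluid d W1" "(x, y) \<in> fluid d W2" using assms z fluid_eq by auto
  have D': "(x + 2 * pi * m, y) \<in> fluid d W1"
    by (rule W1.periodic_fields(1)[OF D(1), of "hvel W1"]) simp
  have shift: "k1 z = k2 z"
    if "k1 \<in> {hvel W1, vvel W1, pressure W1}" "k2 \<in> {hvel W2, vvel W2, pressure W2}"
      "k1 (x + 2 * pi * m, y) = k2 (x + 2 * pi * m, y)" for k1 k2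
    using W1.periodic_fields(2)[OF D(1) that(1), of m] W2.periodic_fields(2)[OF D(2) that(2), of m] that(3) z
    by metis
  show "hvel W1 z = hvel W2 z"
    using shift[of "hvel W1" "hvel W2"] eq_in_period(2)[OF D' m] by simp
  show "vvel W1 z = vvel W2 z"
    using shift[of "vvel W1" "vvel W2"] eq_in_period(3)[OF D' m] by simp
  show "pressure W1 z = pressure W2 z"
    using shift[of "pressure W1" "pressure W2"] pressure_eq_in_period[OF D' m] by simp
qed

end

text \<open>Quantifying \<open>recover\<close> before the waves expresses that reconstruction uses
  the data alone. Each data function is restricted to its interval so that no values elsewhere can
  leak information, and the output fields are restricted because outside the fluid they are
  arbitrary. The flux \<open>p0\<close> is an end point of the domain of the density data.\<close>

theorem theorem4p1:
  fixes g d c Patm :: real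
  assumes "g > 0" and "d > 0"
  shows "\<exists>recover :: real \<Rightarrow> (real \<Rightarrow> real) \<Rightarrow> (real \<Rightarrow> real) \<Rightarrow> (real \<Rightarrow> real) \<Rightarrow> real \<Rightarrow>
            (real \<Rightarrow> real) \<times> (real \<times> real \<Rightarrow> real) \<times> (real \<times> real \<Rightarrow> real) \<times> (real \<times> real \<Rightarrow> real).
          \<forall>W \<psi> p0 r \<beta>.
            symmetric_stratified_wave g d c Patm W \<psi> p0 r \<beta> \<and>
            real_analytic_on r {p0..0} \<and> real_analytic_on \<beta> {0..\<bar>p0\<bar>} \<longrightarrow>
            recover p0 (restrict r {p0..0}) (restrict \<beta> {0..\<bar>p0\<bar>})
                (\<lambda>y\<in>{- d..profile W 0}. hvel W (0, y)) (profile W 0) =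
              (profile W, restrict (hvel W) (fluid d W), restrict (vvel W) (fluid d W),
               restrict (pressure W) (fluid d W))"
proof -
  \<comment> \<open>The relation between data and the waves having them. The witness for
    \<open>recover\<close> outputs the fields of an arbitrary related wave, which is well defined
    once all related waves give the same \<open>out\<close>.\<close>
  define sol where "sol p0 R B U e W \<longleftrightarrow> (\<exists>\<psi> r \<beta>. symmetric_stratified_wave g d c Patm W \<psi> p0 r \<beta> \<and>
      R = restrict r {p0..0} \<and> B = restrict \<beta> {0..\<bar>p0\<bar>} \<and>
      U = (\<lambda>y\<in>{- d..profile W 0}. hvel W (0, y)) \<and> e = profile W 0)" for p0 R B U e W
  define out where "out W = (profile W, restrict (hvel W) (fluid d W), restrict (vvel W) (fluid d W),
      restrict (pressure W) (fluid d W))" for W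
  have "out W' = out W"
    if W: "symmetric_stratified_wave g d c Patm W \<psi> p0 r \<beta>" "real_analytic_on r {p0..0}"
      "real_analytic_on \<beta> {0..\<bar>p0\<bar>}"
      and W': "sol p0 (restrict r {p0..0}) (restrict \<beta> {0..\<bar>p0\<bar>})
        (\<lambda>y\<in>{- d..profile W 0}. hvel W (0, y)) (profile W 0) W'" for W \<psi> p0 r \<beta> W'
  proof -
    obtain \<psi>' r' \<beta>' where s': "symmetric_stratified_wave g d c Patm W' \<psi>' p0 r' \<beta>'"
      and r': "restrict r {p0..0} = restrict r' {p0..0}"
      and \<beta>': "restrict \<beta> {0..\<bar>p0\<bar>} = restrict \<beta>' {0..\<bar>p0\<bar>}"
      and u': "(\<lambda>y\<in>{- d..profile W 0}. hvel W (0, y)) = (\<lambda>y\<in>{- d..profile W' 0}. hvel W' (0, y))"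
      and e: "profile W 0 = profile W' 0"
      using W' unfolding sol_def by blast
    interpret W': symmetric_wave g d c Patm W' \<psi>' p0 r' \<beta>'
      by unfold_locales (use assms s' in auto)
    \<comment> \<open>The second wave is rewritten with the data functions of the first, so that
      their analyticity serves both.\<close>
    have "symmetric_stratified_wave g d c Patm W' \<psi>' p0 r \<beta>"
      using r' \<beta>' by (intro W'.change_data) (metis restrict_apply')+
    moreover have "hvel W (0, y) = hvel W' (0, y)" if "y \<in> {- d..profile W 0}" for y
      using fun_cong[OF u', of y] that e by simp
    ultimately interpret two_waves g d c Patm W \<psi> W' \<psi>' p0 r \<beta>
      by unfold_locales (use assms W e in auto)
    show ?thesis
      using fields_eq fluid_eq profile_eq by (simp add: out_def cong: restrict_cong)
  qed
  moreover have "sol p0 (restrict r {p0..0}) (restrict \<beta> {0..\<bar>p0\<bar>})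
        (\<lambda>y\<in>{- d..profile W 0}. hvel W (0, y)) (profile W 0) W"
    if "symmetric_stratified_wave g d c Patm W \<psi> p0 r \<beta>" for W \<psi> p0 r \<beta>
    using that unfolding sol_def by blast
  ultimately have "out (SOME W'. sol p0 (restrict r {p0..0}) (restrict \<beta> {0..\<bar>p0\<bar>})
        (\<lambda>y\<in>{- d..profile W 0}. hvel W (0, y)) (profile W 0) W') = out W"
    if "symmetric_stratified_wave g d c Patm W \<psi> p0 r \<beta>" "real_analytic_on r {p0..0}"
      "real_analytic_on \<beta> {0..\<bar>p0\<bar>}" for W \<psi> p0 r \<beta>
    using that by (blast intro: someI)
  then show ?thesis unfolding out_def
    by (intro exI[of _ "\<lambda>p0 R B U e. out (SOME W. sol p0 R B U e W)", unfolded out_def]) blast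
qed

end
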